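(* Let $\alpha>0$ be a constant with $\alpha_h\ge\alpha$ for all discretizations considered. There exists a unique $u_h\in\mathcal V_h$ such that $$\mathcal A(u_h,w_h)=\mathcal F(w_h)\qquad\forall\, w_h\in\mathcal W_h=\mathbb S(\mathcal V_h).$$ Moreover, $$\|u-u_h\|_{\mathcal V}\le \frac1\alpha\inf_{v_h\in\mathcal V_h}\|u-v_h\|_{\mathcal V},$$ where $u\in\mathcal V$ is the solution of the variational problem: $\mathcal A(u,w)=\mathcal F(w)$ for all $w\in L^2(\mathcal Q)$.
   Context: Continuous problem. $\Omega\subset\mathbb R^d$ is a bounded Lipschitz domain, $T>0$, $\mathcal Q=(0,T)\times\Omega$, $\Gamma_D=(0,T)\times\partial\Omega$, $\nu>0$ is a constant, $f\in L^2(\mathcal Q)$. All function spaces are complex and $(\cdot,\cdot)$ is the complex $L^2(\mathcal Q)$ scalar product. The Schrödinger operator is $\mathbb S=\mathrm i\partial_t-\nu\Delta$ (in the sense of distributions), with formal adjoint $\mathbb S^*$ (given by the same expression). Set $$\mathcal V=\{v\in L^2(\mathcal Q): \mathbb Sv\in L^2(\mathcal Q),\ (\mathbb S^*w,v)-(w,\mathbb Sv)=0\ \ \forall w\in C_0^\infty(\mathbb R^{d+1})\text{ with } w|_{\Gamma_D\cup(\{T\}\times\Omega)}=0\},$$ $\|v\|_{\mathcal V}^2=\|v\|_{L^2(\mathcal Q)}^2+\|\mathbb Sv\|_{L^2(\mathcal Q)}^2$, and $\mathcal W=L^2(\mathcal Q)$ with $\|w\|_{\mathcal W}=\|w\|_{L^2(\mathcal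 Q)}$. For $v\in\mathcal V$, $w\in\mathcal W$, $$\mathcal A(v,w)=\int_\Omega\int_0^T(\mathbb Sv)\,\overline w\,dt\,d\Omega,\qquad \mathcal F(w)=\int_\Omega\int_0^T f\,\overline w\,dt\,d\Omega.$$ The variational problem "find $u\in\mathcal V$ with $\mathcal A(u,w)=\mathcal F(w)$ for all $w\in\mathcal W$" is well posed (it has a unique solution). Spline spaces. For a degree $p$ and an open knot vector in $[0,1]$ (first and last knots repeated $p+1$ times), the univariate spline space is the span of the associated B-splines of degree $p$; the mesh size is the maximal knot span. $\widehat{\mathcal S}^{p_t}_{h_t}$ is such a space in the time variable $\tau\in(0,1)$, and $\widehat{\mathcal S}^{\boldsymbol p_s}_{h_s}$ is the tensor product of $d$ such spaces, all of degree $p_s$, on $\widehat\Omega=(0,1)^d$; $h_t$ is the time mesh size, $h_s$ the maximum of the spatial mesh sizes, and $h=\max\{h_t,h_s\}$. It is assumed that $p_t\ge1$, $p_s\ge2$, $\widehat{\mathcal S}^{p_t}_{h_t}\subset C^0((0,1))$, $\widehat{\mathcal S}^{\boldsymbol p_s}_{h_s}\subset C^1(\widehat\Omega)$. Local quasi-uniformity is also assumed: there is $\theta\ge1$, independent of $h_s,h_t$, such that in each of the $d+1$ univariate meshes the ratio of the lengths of any two adjacent nonempty knot spans lies in $[\theta^{-1},\theta]$. The domain $\Omega$ is parametrized by $\boldsymbol F:\widehat\Omega\to\Omega$ with components in $\widehat{\mathcal S}^{\boldsymbol p_s}_{h_s}$ (on the closure of $\widehat\Omega$) and with $\boldsymbol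 F^{-1}$ having piecewise bounded derivatives of any order; $\boldsymbol G(\tau,\boldsymbol\eta)=(T\tau,\boldsymbol F(\boldsymbol\eta))$. Discrete spaces. $\widehat{\mathcal X}_{h,0}$ is the space of $\widehat v_h\in\widehat{\mathcal S}^{p_t}_{h_t}\otimes\widehat{\mathcal S}^{\boldsymbol p_s}_{h_s}$ (with complex coefficients) vanishing on $\{0\}\times\widehat\Omega$ and on $(0,1)\times\partial\widehat\Omega$; $\mathcal V_h=\{\widehat v_h\circ\boldsymbol G^{-1}:\widehat v_h\in\widehat{\mathcal X}_{h,0}\}$, endowed with $\|\cdot\|_{\mathcal V}$; $\mathcal W_h=\mathbb S(\mathcal V_h)$, endowed with $\|\cdot\|_{\mathcal W}$. The discrete inf-sup constant is $$\alpha_h=\inf_{0\ne v_h\in\mathcal V_h}\ \sup_{0\ne w_h\in\mathcal W_h}\frac{|\mathcal A(v_h,w_h)|}{\|v_h\|_{\mathcal V}\|w_h\|_{\mathcal W}}.$$ Standing assumption: the constants $\alpha_h$ are bounded from below by a constant $\alpha>0$ uniformly in the discretization. *)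

theory Defs
  imports "HOL-Analysis.Analysis"
begin

section \<open>Smooth functions and Lipschitz domains\<close>

text \<open>\<open>iter_deriv [b\<^sub>1, \<dots>, b\<^sub>k] f\<close> is the iterated directional derivative
  \<open>\<partial>\<^bsub>b\<^sub>1\<^esub> \<dots> \<partial>\<^bsub>b\<^sub>k\<^esub> f\<close>; the predicates below are meant for open sets.\<close>

primrec iter_deriv ::
  "'a::real_normed_vector list \<Rightarrow> ('a \<Rightarrow> 'b::real_normed_vector) \<Rightarrow> 'a \<Rightarrow> 'b" where
  "iter_deriv [] f = f"
| "iter_deriv (b # bs) f = (\<lambda>x. frechet_derivative (iter_deriv bs f) (at x) b)"

definition smooth_on ::
  "'a::real_normed_vector set \<Rightarrow> ('a \<Rightarrow> 'b::real_normed_vector) \<Rightarrow> bool" where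
  "smooth_on U f \<longleftrightarrow> (\<forall>bs. \<forall>x\<in>U. iter_deriv bs f differentiable (at x))"

definition C1_on ::
  "'a::real_normed_vector set \<Rightarrow> ('a \<Rightarrow> 'b::real_normed_vector) \<Rightarrow> bool" where
  "C1_on U f \<longleftrightarrow> (\<forall>x\<in>U. f differentiable (at x)) \<and>
     (\<forall>b. continuous_on U (\<lambda>x. frechet_derivative f (at x) b))"

definition smooth_bounded_on ::
  "'a::real_normed_vector set \<Rightarrow> ('a \<Rightarrow> 'b::real_normed_vector) \<Rightarrow> bool" where
  "smooth_bounded_on U f \<longleftrightarrow> smooth_on U f \<and> (\<forall>bs. bounded (iter_deriv bs f ` U))"

text \<open>Smooth functions on the whole space with compact support contained in \<open>U\<close>.\<close>

definition test_function ::
  "'a::real_normed_vector set \<Rightarrow> ('a \<Rightarrow> complex) \<Rightarrow> bool" where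
  "test_function U w \<longleftrightarrow> smooth_on UNIV w \<and>
     compact (closure {x. w x \<noteq> 0}) \<and> closure {x. w x \<noteq> 0} \<subseteq> U"

text \<open>Near each boundary point, the domain is the strict epigraph, in the direction of a unit
  vector \<open>n\<close>, of a Lipschitz function of the coordinates orthogonal to \<open>n\<close>. Such a function is
  represented by a \<open>\<gamma>\<close> on the whole space that is constant along \<open>n\<close>.\<close>

definition lipschitz_domain :: "'a::euclidean_space set \<Rightarrow> bool" where
  "lipschitz_domain \<Omega> \<longleftrightarrow> open \<Omega> \<and> connected \<Omega> \<and> \<Omega> \<noteq> {} \<and>
     (\<forall>x\<in>frontier \<Omega>. \<exists>n \<gamma> L r. norm n = 1 \<and> 0 < r \<and> L-lipschitz_on UNIV \<gamma> \<and>
        (\<forall>y s. \<gamma> (y + s *\<^sub>R n) = \<gamma> y) \<and>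
        \<Omega> \<inter> ball x r = {y \<in> ball x r. \<gamma> y < y \<bullet> n})"


section \<open>The space L2 on an open set\<close>

text \<open>Elements of \<open>L\<^sup>2(Q)\<close> are represented by functions; their values outside \<open>Q\<close> are irrelevant,
  and equality in \<open>L\<^sup>2(Q)\<close> is equality almost everywhere in \<open>Q\<close>.\<close>

definition L2 :: "'a::euclidean_space set \<Rightarrow> ('a \<Rightarrow> complex) set" where
  "L2 Q = {v \<in> borel_measurable (lebesgue_on Q).
             integrable (lebesgue_on Q) (\<lambda>x. (cmod (v x))\<^sup>2)}"

definition L2_ip :: "'a::euclidean_space set \<Rightarrow> ('a \<Rightarrow> complex) \<Rightarrow> ('a \<Rightarrow> complex) \<Rightarrow> complex" where
  "L2_ip Q v w = (LINT x|lebesgue_on Q. v x * cnj (w x))"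

definition L2_norm :: "'a::euclidean_space set \<Rightarrow> ('a \<Rightarrow> complex) \<Rightarrow> real" where
  "L2_norm Q v = sqrt (LINT x|lebesgue_on Q. (cmod (v x))\<^sup>2)"

definition L2_nonzero :: "'a::euclidean_space set \<Rightarrow> ('a \<Rightarrow> complex) \<Rightarrow> bool" where
  "L2_nonzero Q v \<longleftrightarrow> \<not> (AE x in lebesgue_on Q. v x = 0)"


section \<open>The Schroedinger operator and the continuous problem\<close>

definition cylinder :: "real \<Rightarrow> 'a set \<Rightarrow> (real \<times> 'a) set" where
  "cylinder T \<Omega> = {0<..<T} \<times> \<Omega>"

text \<open>\<open>\<i> \<partial>\<^sub>t w - \<nu> \<Delta> w\<close> for smooth \<open>w\<close>. This is also the formal adjoint.\<close>

definition schroedinger ::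
  "real \<Rightarrow> (real \<times> (real^'d) \<Rightarrow> complex) \<Rightarrow> real \<times> (real^'d) \<Rightarrow> complex" where
  "schroedinger \<nu> w = (\<lambda>p. \<i> * iter_deriv [(1, 0)] w p
      - of_real \<nu> * (\<Sum>j\<in>UNIV. iter_deriv [(0, axis j 1), (0, axis j 1)] w p))"

text \<open>\<open>g = \<S> v\<close> in the sense of distributions on \<open>Q\<close>, for \<open>v\<close> and \<open>g\<close> in \<open>L\<^sup>2(Q)\<close>.\<close>

definition weak_schroedinger ::
  "real \<Rightarrow> (real \<times> (real^'d)) set \<Rightarrow> (real \<times> (real^'d) \<Rightarrow> complex) \<Rightarrow>
   (real \<times> (real^'d) \<Rightarrow> complex) \<Rightarrow> bool" where
  "weak_schroedinger \<nu> Q v g \<longleftrightarrow>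
     (\<forall>\<phi>. test_function Q \<phi> \<longrightarrow> L2_ip Q v (schroedinger \<nu> \<phi>) = L2_ip Q g \<phi>)"

text \<open>A representative of \<open>\<S> v\<close>, meaningful if the distribution \<open>\<S> v\<close> belongs to \<open>L\<^sup>2(Q)\<close>.\<close>

definition S_op ::
  "real \<Rightarrow> (real \<times> (real^'d)) set \<Rightarrow> (real \<times> (real^'d) \<Rightarrow> complex) \<Rightarrow>
   real \<times> (real^'d) \<Rightarrow> complex" where
  "S_op \<nu> Q v = (SOME g. g \<in> L2 Q \<and> weak_schroedinger \<nu> Q v g)"

definition V_space ::
  "real \<Rightarrow> real \<Rightarrow> (real^'d) set \<Rightarrow> (real \<times> (real^'d) \<Rightarrow> complex) set" where
  "V_space \<nu> T \<Omega> = {v \<in> L2 (cylinder T \<Omega>).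
     (\<exists>g \<in> L2 (cylinder T \<Omega>). weak_schroedinger \<nu> (cylinder T \<Omega>) v g) \<and>
     (\<forall>w. test_function UNIV w \<longrightarrow>
          (\<forall>p \<in> {0<..<T} \<times> frontier \<Omega> \<union> {T} \<times> \<Omega>. w p = 0) \<longrightarrow>
          L2_ip (cylinder T \<Omega>) (schroedinger \<nu> w) v
            - L2_ip (cylinder T \<Omega>) w (S_op \<nu> (cylinder T \<Omega>) v) = 0)}"

text \<open>The norm of \<open>V_space\<close>, with the value infinity outside the space. In the quotient
  defining the inf-sup constant below, a function outside the space therefore counts as zero.\<close>

definition V_norm ::
  "real \<Rightarrow> real \<Rightarrow> (real^'d) set \<Rightarrow> (real \<times> (real^'d) \<Rightarrow> complex) \<Rightarrow> ennreal" where
  "V_norm \<nu> T \<Omega> v =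
     (if v \<in> V_space \<nu> T \<Omega>
      then ennreal (sqrt ((L2_norm (cylinder T \<Omega>) v)\<^sup>2
                     + (L2_norm (cylinder T \<Omega>) (S_op \<nu> (cylinder T \<Omega>) v))\<^sup>2))
      else \<infinity>)"

definition A_form ::
  "real \<Rightarrow> real \<Rightarrow> (real^'d) set \<Rightarrow> (real \<times> (real^'d) \<Rightarrow> complex) \<Rightarrow>
   (real \<times> (real^'d) \<Rightarrow> complex) \<Rightarrow> complex" where
  "A_form \<nu> T \<Omega> v w =
     (LINT p|lebesgue_on (cylinder T \<Omega>). S_op \<nu> (cylinder T \<Omega>) v p * cnj (w p))"

definition F_form ::
  "real \<Rightarrow> (real^'d) set \<Rightarrow> (real \<times> (real^'d) \<Rightarrow> complex) \<Rightarrow>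
   (real \<times> (real^'d) \<Rightarrow> complex) \<Rightarrow> complex" where
  "F_form T \<Omega> f w = (LINT p|lebesgue_on (cylinder T \<Omega>). f p * cnj (w p))"


section \<open>Spline spaces\<close>

definition open_knot_vector :: "nat \<Rightarrow> real list \<Rightarrow> bool" where
  "open_knot_vector p \<Xi> \<longleftrightarrow> sorted \<Xi> \<and> set \<Xi> \<subseteq> {0..1} \<and>
     count_list \<Xi> 0 = p + 1 \<and> count_list \<Xi> 1 = p + 1"

text \<open>Cox--de Boor recursion. Quotients with denominator zero count as zero, and the last nonempty
  knot span is closed on the right, so that splines are left continuous at the last knot.\<close>

fun bspline :: "real list \<Rightarrow> nat \<Rightarrow> nat \<Rightarrow> real \<Rightarrow> real" where
  "bspline \<Xi> 0 i x =
     (if \<Xi> ! i \<le> x \<and> x < \<Xi> ! (i + 1) \<or> \<Xi> ! i < x \<and> x = \<Xi> ! (i + 1) \<and> x = last \<Xi>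
      then 1 else 0)"
| "bspline \<Xi> (Suc p) i x =
     (x - \<Xi> ! i) / (\<Xi> ! (i + p + 1) - \<Xi> ! i) * bspline \<Xi> p i x
   + (\<Xi> ! (i + p + 2) - x) / (\<Xi> ! (i + p + 2) - \<Xi> ! (i + 1)) * bspline \<Xi> p (i + 1) x"

definition spline_dim :: "nat \<Rightarrow> real list \<Rightarrow> nat" where
  "spline_dim p \<Xi> = length \<Xi> - (p + 1)"

definition spline_space :: "nat \<Rightarrow> real list \<Rightarrow> (real \<Rightarrow> real) set" where
  "spline_space p \<Xi> = {s. \<exists>c. s = (\<lambda>x. \<Sum>i<spline_dim p \<Xi>. c i * bspline \<Xi> p i x)}"

definition tensor_index :: "nat \<Rightarrow> ('d::finite \<Rightarrow> real list) \<Rightarrow> ('d \<Rightarrow> nat) set" where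
  "tensor_index p \<Xi> = {i. \<forall>j. i j < spline_dim p (\<Xi> j)}"

definition tensor_bspline ::
  "('d::finite \<Rightarrow> real list) \<Rightarrow> nat \<Rightarrow> ('d \<Rightarrow> nat) \<Rightarrow> real^'d \<Rightarrow> real" where
  "tensor_bspline \<Xi> p i \<eta> = (\<Prod>j\<in>UNIV. bspline (\<Xi> j) p (i j) (\<eta> $ j))"

definition tensor_spline_space ::
  "nat \<Rightarrow> ('d::finite \<Rightarrow> real list) \<Rightarrow> (real^'d \<Rightarrow> real) set" where
  "tensor_spline_space p \<Xi> =
     {s. \<exists>c. s = (\<lambda>\<eta>. \<Sum>i\<in>tensor_index p \<Xi>. c i * tensor_bspline \<Xi> p i \<eta>)}"

definition breakpoints :: "real list \<Rightarrow> real list" where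
  "breakpoints \<Xi> = sorted_list_of_set (set \<Xi>)"

definition locally_quasi_uniform :: "real \<Rightarrow> real list \<Rightarrow> bool" where
  "locally_quasi_uniform \<theta> \<Xi> \<longleftrightarrow>
     (let \<zeta> = breakpoints \<Xi> in \<forall>i. i + 2 < length \<zeta> \<longrightarrow>
        (\<zeta> ! (i + 2) - \<zeta> ! (i + 1)) / (\<zeta> ! (i + 1) - \<zeta> ! i) \<in> {1 / \<theta> .. \<theta>})"

definition mesh_elements :: "('d::finite \<Rightarrow> real list) \<Rightarrow> (real^'d) set set" where
  "mesh_elements \<Xi> =
     {{\<eta>. \<forall>j. breakpoints (\<Xi> j) ! k j < \<eta> $ j \<and> \<eta> $ j < breakpoints (\<Xi> j) ! (k j + 1)} | k.
        \<forall>j. k j + 1 < length (breakpoints (\<Xi> j))}"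


section \<open>The discrete spaces\<close>

definition spline_parametrization ::
  "nat \<Rightarrow> ('d::finite \<Rightarrow> real list) \<Rightarrow> (real^'d) set \<Rightarrow> (real^'d \<Rightarrow> real^'d) \<Rightarrow> bool" where
  "spline_parametrization p \<Xi> \<Omega> F \<longleftrightarrow> bij_betw F (box 0 1) \<Omega> \<and>
     (\<forall>j. \<exists>s\<in>tensor_spline_space p \<Xi>. \<forall>\<eta>\<in>cbox 0 1. F \<eta> $ j = s \<eta>) \<and>
     (\<forall>E\<in>mesh_elements \<Xi>. smooth_bounded_on (F ` E) (inv_into (box 0 1) F))"

definition X_h0 ::
  "nat \<Rightarrow> nat \<Rightarrow> real list \<Rightarrow> ('d::finite \<Rightarrow> real list) \<Rightarrow> (real \<times> (real^'d) \<Rightarrow> complex) set" where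
  "X_h0 pt ps \<Xi>t \<Xi>s = {v.
     (\<exists>c. v = (\<lambda>(\<tau>, \<eta>). \<Sum>k<spline_dim pt \<Xi>t. \<Sum>i\<in>tensor_index ps \<Xi>s.
                 c k i * of_real (bspline \<Xi>t pt k \<tau> * tensor_bspline \<Xi>s ps i \<eta>))) \<and>
     (\<forall>p \<in> {0} \<times> box 0 1 \<union> {0<..<1} \<times> frontier (box 0 1). v p = 0)}"

definition G_map :: "real \<Rightarrow> (real^'d \<Rightarrow> real^'d) \<Rightarrow> real \<times> (real^'d) \<Rightarrow> real \<times> (real^'d)" where
  "G_map T F = (\<lambda>(\<tau>, \<eta>). (T * \<tau>, F \<eta>))"

text \<open>The functions are extended by zero outside the cylinder, so that equality of elements of the
  discrete space is equality of functions.\<close>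

definition V_h ::
  "real \<Rightarrow> (real^'d) set \<Rightarrow> (real^'d \<Rightarrow> real^'d) \<Rightarrow> nat \<Rightarrow> nat \<Rightarrow> real list \<Rightarrow>
   ('d::finite \<Rightarrow> real list) \<Rightarrow> (real \<times> (real^'d) \<Rightarrow> complex) set" where
  "V_h T \<Omega> F pt ps \<Xi>t \<Xi>s =
     (\<lambda>v p. if p \<in> cylinder T \<Omega> then v (inv_into ({0<..<1} \<times> box 0 1) (G_map T F) p) else 0)
       ` X_h0 pt ps \<Xi>t \<Xi>s"

text \<open>All representatives of the classes \<open>\<S> v\<close>, for \<open>v\<close> in the given set.\<close>

definition S_image ::
  "real \<Rightarrow> real \<Rightarrow> (real^'d) set \<Rightarrow> (real \<times> (real^'d) \<Rightarrow> complex) set \<Rightarrow>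
   (real \<times> (real^'d) \<Rightarrow> complex) set" where
  "S_image \<nu> T \<Omega> Vh =
     {w \<in> L2 (cylinder T \<Omega>). \<exists>v\<in>Vh. weak_schroedinger \<nu> (cylinder T \<Omega>) v w}"

definition inf_sup_const ::
  "real \<Rightarrow> real \<Rightarrow> (real^'d) set \<Rightarrow> (real \<times> (real^'d) \<Rightarrow> complex) set \<Rightarrow>
   (real \<times> (real^'d) \<Rightarrow> complex) set \<Rightarrow> ennreal" where
  "inf_sup_const \<nu> T \<Omega> Vh Wh =
     (INF v\<in>{v \<in> Vh. L2_nonzero (cylinder T \<Omega>) v}.
        SUP w\<in>{w \<in> Wh. L2_nonzero (cylinder T \<Omega>) w}.
          ennreal (cmod (A_form \<nu> T \<Omega> v w)) /
            (V_norm \<nu> T \<Omega> v * ennreal (L2_norm (cylinder T \<Omega>) w)))"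

end

theory Submission
  imports Defs "HOL-Library.Function_Algebras"
begin

text \<open>Write \<open>S\<close> for the Schroedinger operator. Because the test space is \<open>S(V\<^sub>h)\<close>, the discrete problem
  reads \<open>(S u\<^sub>h, S v) = (f, S v)\<close> for all \<open>v \<in> V\<^sub>h\<close>: it is the least squares problem for \<open>S u = f\<close> on
  \<open>V\<^sub>h\<close>. The inf-sup condition, with Cauchy--Schwarz, says that \<open>\<alpha> \<parallel>v\<parallel> \<le> \<parallel>S v\<parallel>\<close> on \<open>V\<^sub>h\<close>, where
  \<open>\<parallel>v\<parallel>\<close> is the graph norm (\<open>inf_sup_const_imp_stable\<close>). It also forces \<open>V\<^sub>h\<close> into the graph space,
  since a function outside has infinite norm. So the form \<open>(S u, S v)\<close> is definite on the finite
  dimensional space \<open>V\<^sub>h\<close>, and a Gram--Schmidt argument (\<open>finite_dim_riesz\<close>) yields the unique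
  solution.

  For the error, let \<open>v \<in> V\<^sub>h\<close>, \<open>a = u - u\<^sub>h\<close> and \<open>z = v - u\<^sub>h\<close>. Then \<open>S a\<close> is orthogonal to \<open>S z\<close>, so
  \<open>\<parallel>u - v\<parallel>\<^sup>2 = \<parallel>a - z\<parallel>\<^sup>2\<close> is at least \<open>(|a| - |z|)\<^sup>2 + |S a|\<^sup>2 + |S z|\<^sup>2\<close>, with \<open>|.|\<close> the norm of
  \<open>L\<^sup>2\<close>. Together with the stability of \<open>z\<close> and with \<open>\<alpha> \<le> 1\<close>, an elementary inequality
  (\<open>stable_projection_inequality\<close>) bounds this below by \<open>\<alpha>\<^sup>2 \<parallel>a\<parallel>\<^sup>2\<close>. This replaces Kato's identity for
  the norms of complementary projections. The condition \<open>\<alpha> \<le> 1\<close> holds because \<open>V\<^sub>h\<close> contains a nonzero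
  function, built from the second B-spline in each direction (\<open>X_h0_nontrivial\<close>).

  Two points concern representatives. The weak image \<open>S v\<close> is a chosen function, and it depends linearly
  on \<open>v\<close> almost everywhere by the fundamental lemma of the calculus of variations, which is proved from
  explicit smooth bumps (\<open>AE_eq_0_if_orthogonal_to_test_functions\<close>). Elements of \<open>V\<^sub>h\<close> are compared as
  functions; one that vanishes almost everywhere vanishes identically, since splines are continuous
  and the parametrization is open by invariance of domain (\<open>continuous_pullback_AE_eq_0\<close>).\<close>

section \<open>The inner product of square integrable functions\<close>

lemma L2_measurable: "v \<in> L2 Q \<Longrightarrow> v \<in> borel_measurable (lebesgue_on Q)"
  by (simp add: L2_def)

lemma L2_square_integrable: "v \<in> L2 Q \<Longrightarrow> integrable (lebesgue_on Q) (\<lambda>x. (cmod (v x))\<^sup>2)"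
  by (simp add: L2_def)

lemma integrable_mult_cnj:
  assumes v: "v \<in> L2 Q" and w: "w \<in> L2 Q"
  shows "integrable (lebesgue_on Q) (\<lambda>x. v x * cnj (w x))"
proof (rule Bochner_Integration.integrable_bound)
  show "integrable (lebesgue_on Q) (\<lambda>x. (cmod (v x))\<^sup>2 + (cmod (w x))\<^sup>2)"
    using v w by (intro Bochner_Integration.integrable_add L2_square_integrable)
  have [measurable]: "v \<in> borel_measurable (lebesgue_on Q)" "w \<in> borel_measurable (lebesgue_on Q)"
    using v w by (auto dest: L2_measurable)
  have "cnj \<in> borel_measurable (borel :: complex measure)"
    by (intro borel_measurable_continuous_onI continuous_intros)
  then have [measurable]: "(\<lambda>x. cnj (w x)) \<in> borel_measurable (lebesgue_on Q)"
    by (rule measurable_compose[OF L2_measurable[OF w]])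
  show "(\<lambda>x. v x * cnj (w x)) \<in> borel_measurable (lebesgue_on Q)"
    by measurable
  have "cmod (v x * cnj (w x)) \<le> (cmod (v x))\<^sup>2 + (cmod (w x))\<^sup>2" for x
  proof -
    have "0 \<le> (cmod (v x) - cmod (w x))\<^sup>2" by simp
    moreover have "0 \<le> cmod (v x) * cmod (w x)" by simp
    ultimately show ?thesis
      unfolding norm_mult complex_mod_cnj power2_diff by linarith
  qed
  then show "AE x in lebesgue_on Q. norm (v x * cnj (w x))
      \<le> norm ((cmod (v x))\<^sup>2 + (cmod (w x))\<^sup>2)"
    by auto
qed

lemma L2_add:
  assumes v: "v \<in> L2 Q" and w: "w \<in> L2 Q"
  shows "(\<lambda>x. v x + w x) \<in> L2 Q"
proof -
  have [measurable]: "v \<in> borel_measurable (lebesgue_on Q)" "w \<in> borel_measurable (lebesgue_on Q)"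
    using v w by (auto dest: L2_measurable)
  have "integrable (lebesgue_on Q) (\<lambda>x. (cmod (v x + w x))\<^sup>2)"
  proof (rule Bochner_Integration.integrable_bound)
    show "integrable (lebesgue_on Q) (\<lambda>x. 2 * (cmod (v x))\<^sup>2 + 2 * (cmod (w x))\<^sup>2)"
      using v w by (intro Bochner_Integration.integrable_add integrable_mult_right L2_square_integrable)
    have "(cmod (v x + w x))\<^sup>2 \<le> 2 * (cmod (v x))\<^sup>2 + 2 * (cmod (w x))\<^sup>2" for x
    proof -
      have "(cmod (v x + w x))\<^sup>2 \<le> (cmod (v x) + cmod (w x))\<^sup>2"
        by (intro power_mono norm_triangle_ineq) simp
      moreover have "0 \<le> (cmod (v x) - cmod (w x))\<^sup>2" by simp
      ultimately show ?thesis
        unfolding power2_diff power2_sum by linarith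
    qed
    then show "AE x in lebesgue_on Q. norm ((cmod (v x + w x))\<^sup>2)
        \<le> norm (2 * (cmod (v x))\<^sup>2 + 2 * (cmod (w x))\<^sup>2)"
      by auto
  qed measurable
  then show ?thesis by (simp add: L2_def)
qed

lemma L2_scale:
  assumes v: "v \<in> L2 Q"
  shows "(\<lambda>x. c * v x) \<in> L2 Q"
proof -
  have [measurable]: "v \<in> borel_measurable (lebesgue_on Q)"
    using v by (auto dest: L2_measurable)
  show ?thesis
    using L2_square_integrable[OF v] by (simp add: L2_def norm_mult power_mult_distrib)
qed

lemma L2_diff:
  assumes v: "v \<in> L2 Q" and w: "w \<in> L2 Q"
  shows "(\<lambda>x. v x - w x) \<in> L2 Q"
  using L2_add[OF v L2_scale[OF w, of "-1"]] by simp

lemma L2_zero: "(\<lambda>x. 0) \<in> L2 Q"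
  by (simp add: L2_def)

lemma L2_ip_add_left:
  assumes "v \<in> L2 Q" "v' \<in> L2 Q" "w \<in> L2 Q"
  shows "L2_ip Q (\<lambda>x. v x + v' x) w = L2_ip Q v w + L2_ip Q v' w"
  unfolding L2_ip_def distrib_right
  using assms by (intro Bochner_Integration.integral_add integrable_mult_cnj)

lemma L2_ip_scale_left: "L2_ip Q (\<lambda>x. c * v x) w = c * L2_ip Q v w"
  unfolding L2_ip_def mult.assoc by simp

lemma L2_ip_diff_left:
  assumes "v \<in> L2 Q" "v' \<in> L2 Q" "w \<in> L2 Q"
  shows "L2_ip Q (\<lambda>x. v x - v' x) w = L2_ip Q v w - L2_ip Q v' w"
  unfolding L2_ip_def left_diff_distrib
  using assms by (intro Bochner_Integration.integral_diff integrable_mult_cnj)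

lemma L2_ip_commute: "L2_ip Q w v = cnj (L2_ip Q v w)"
proof -
  have "cnj (L2_ip Q v w) = (LINT x|lebesgue_on Q. cnj (v x * cnj (w x)))"
    unfolding L2_ip_def by (rule Bochner_Integration.integral_cnj[symmetric])
  then show ?thesis by (simp add: L2_ip_def mult.commute)
qed

lemma L2_ip_add_right:
  assumes "v \<in> L2 Q" "w \<in> L2 Q" "w' \<in> L2 Q"
  shows "L2_ip Q v (\<lambda>x. w x + w' x) = L2_ip Q v w + L2_ip Q v w'"
  using assms by (simp add: L2_ip_commute[of Q v] L2_ip_add_left)

lemma L2_ip_scale_right: "L2_ip Q v (\<lambda>x. c * w x) = cnj c * L2_ip Q v w"
  by (simp add: L2_ip_commute[of Q v] L2_ip_scale_left)

lemma L2_ip_cong_AE: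
  assumes "AE x in lebesgue_on Q. v x = v' x" "AE x in lebesgue_on Q. w x = w' x"
    and "v \<in> L2 Q" "v' \<in> L2 Q" "w \<in> L2 Q" "w' \<in> L2 Q"
  shows "L2_ip Q v w = L2_ip Q v' w'"
  unfolding L2_ip_def
proof (rule integral_cong_AE)
  show "AE x in lebesgue_on Q. v x * cnj (w x) = v' x * cnj (w' x)"
    using assms(1,2) by eventually_elim simp
qed (use assms in \<open>auto intro: borel_measurable_integrable integrable_mult_cnj\<close>)

lemma L2_norm_nonneg: "0 \<le> L2_norm Q v"
  by (simp add: L2_norm_def)

lemma L2_norm_square: "(L2_norm Q v)\<^sup>2 = (LINT x|lebesgue_on Q. (cmod (v x))\<^sup>2)"
  by (simp add: L2_norm_def)

lemma L2_ip_self: "L2_ip Q v v = of_real ((L2_norm Q v)\<^sup>2)"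
  unfolding L2_ip_def L2_norm_square complex_norm_square[symmetric] of_real_power[symmetric]
  by (rule integral_complex_of_real)

lemma L2_norm_cong_AE:
  assumes "AE x in lebesgue_on Q. v x = v' x" "v \<in> L2 Q" "v' \<in> L2 Q"
  shows "L2_norm Q v = L2_norm Q v'"
  using L2_ip_cong_AE[OF assms(1) assms(1) assms(2,3) assms(2,3)]
  by (metis L2_ip_self L2_norm_nonneg of_real_eq_iff power2_eq_imp_eq)

lemma L2_norm_eq_0_iff:
  assumes "v \<in> L2 Q"
  shows "L2_norm Q v = 0 \<longleftrightarrow> (AE x in lebesgue_on Q. v x = 0)"
  unfolding L2_norm_def
  using integral_nonneg_eq_0_iff_AE[OF L2_square_integrable[OF assms]] by simp

lemma L2_norm_diff_square:
  assumes "v \<in> L2 Q" "w \<in> L2 Q"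
  shows "(L2_norm Q (\<lambda>x. v x - w x))\<^sup>2 = (L2_norm Q v)\<^sup>2 + (L2_norm Q w)\<^sup>2 - 2 * Re (L2_ip Q v w)"
proof -
  let ?d = "\<lambda>x. v x - w x"
  have d: "?d \<in> L2 Q" using assms by (rule L2_diff)
  have "L2_ip Q ?d ?d = L2_ip Q v ?d - L2_ip Q w ?d"
    by (rule L2_ip_diff_left[OF assms d])
  also have "\<dots> = cnj (L2_ip Q ?d v) - cnj (L2_ip Q ?d w)"
    by (simp add: L2_ip_commute[of Q _ ?d])
  also have "\<dots> = cnj (L2_ip Q v v) - cnj (L2_ip Q w v) - (cnj (L2_ip Q v w) - cnj (L2_ip Q w w))"
    by (simp add: L2_ip_diff_left assms)
  finally have "Re (L2_ip Q ?d ?d) = (L2_norm Q v)\<^sup>2 + (L2_norm Q w)\<^sup>2 - 2 * Re (L2_ip Q v w)"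
    by (simp add: L2_ip_self L2_ip_commute[of Q w v])
  then show ?thesis
    unfolding L2_ip_self by simp
qed

lemma L2_Cauchy_Schwarz:
  assumes v: "v \<in> L2 Q" and w: "w \<in> L2 Q"
  shows "cmod (L2_ip Q v w) \<le> L2_norm Q v * L2_norm Q w"
proof (cases "L2_norm Q w = 0")
  case True
  then have "AE x in lebesgue_on Q. w x = 0"
    using L2_norm_eq_0_iff[OF w] by simp
  then have "AE x in lebesgue_on Q. v x * cnj (w x) = 0"
    by eventually_elim simp
  then have "L2_ip Q v w = 0"
    unfolding L2_ip_def by (rule integral_eq_zero_AE)
  then show ?thesis using True by simp
next
  case False
  let ?c = "L2_ip Q v w / of_real ((L2_norm Q w)\<^sup>2)"
  let ?N = "(L2_norm Q w)\<^sup>2"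
  have N: "?N > 0" using False by simp
  have "0 \<le> (L2_norm Q (\<lambda>x. v x - ?c * w x))\<^sup>2" by simp
  also have "\<dots> = (L2_norm Q v)\<^sup>2 + (L2_norm Q (\<lambda>x. ?c * w x))\<^sup>2 - 2 * Re (L2_ip Q v (\<lambda>x. ?c * w x))"
    by (intro L2_norm_diff_square v L2_scale w)
  also have "(L2_norm Q (\<lambda>x. ?c * w x))\<^sup>2 = (cmod ?c)\<^sup>2 * ?N"
    unfolding L2_norm_square norm_mult power_mult_distrib by (rule integral_mult_right_zero)
  also have "(cmod ?c)\<^sup>2 * ?N = (cmod (L2_ip Q v w))\<^sup>2 / ?N"
    using N unfolding norm_divide power_divide norm_of_real abs_power2 by (simp add: power2_eq_square)
  also have "L2_ip Q v (\<lambda>x. ?c * w x) = cnj ?c * L2_ip Q v w"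
    unfolding L2_ip_commute[of Q v "\<lambda>x. ?c * w x"] L2_ip_scale_left
    by (simp add: L2_ip_commute[of Q w v])
  also have "Re (cnj ?c * L2_ip Q v w) = (cmod (L2_ip Q v w))\<^sup>2 / ?N"
  proof -
    have "cnj ?c * L2_ip Q v w = of_real ((cmod (L2_ip Q v w))\<^sup>2 / ?N)"
      using complex_norm_square[of "L2_ip Q v w"] by (simp add: mult.commute)
    then show ?thesis by (metis Re_complex_of_real)
  qed
  finally have "(cmod (L2_ip Q v w))\<^sup>2 / ?N \<le> (L2_norm Q v)\<^sup>2" by simp
  then have "(cmod (L2_ip Q v w))\<^sup>2 \<le> (L2_norm Q v * L2_norm Q w)\<^sup>2"
    using N by (simp add: divide_le_eq power_mult_distrib)
  then show ?thesis
    by (rule power2_le_imp_le) (simp add: L2_norm_nonneg)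
qed

lemma L2_imp_integrable:
  assumes "g \<in> L2 Q" "Q \<in> lmeasurable"
  shows "integrable (lebesgue_on Q) g"
proof -
  have fin: "finite_measure (lebesgue_on Q)"
    using assms(2) by (rule finite_measure_lebesgue_on)
  then have "(\<lambda>x. 1) \<in> L2 Q"
    by (auto simp: L2_def finite_measure.integrable_const)
  from integrable_mult_cnj[OF assms(1) this] show ?thesis by simp
qed

lemma continuous_imp_L2:
  assumes f: "continuous_on UNIV f" and Q: "bounded Q" "Q \<in> sets lebesgue"
  shows "f \<in> L2 Q"
proof -
  have "finite_measure (lebesgue_on Q)"
    using Q by (intro finite_measure_lebesgue_on) (simp add: bounded_set_imp_lmeasurable)
  then interpret finite_measure "lebesgue_on Q" .
  have "bounded (f ` closure Q)"
    using Q by (intro compact_imp_bounded compact_continuous_image continuous_on_subset[OF f]) auto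
  then obtain B where B: "\<And>x. x \<in> Q \<Longrightarrow> cmod (f x) \<le> B"
    unfolding bounded_iff using closure_subset by blast
  have [measurable]: "f \<in> borel_measurable (lebesgue_on Q)"
    using f by (intro measurable_restrict_space1 measurable_completion)
      (simp add: borel_measurable_continuous_onI)
  have "integrable (lebesgue_on Q) (\<lambda>x. (cmod (f x))\<^sup>2)"
  proof (rule integrable_const_bound[where B = "B\<^sup>2"])
    show "AE x in lebesgue_on Q. norm ((cmod (f x))\<^sup>2) \<le> B\<^sup>2"
      using B by (auto intro!: AE_I2 power_mono)
  qed measurable
  then show ?thesis by (simp add: L2_def)
qed

section \<open>Smooth bumps and the fundamental lemma of the calculus of variations\<close>

text \<open>The powers of \<open>1 / t\<close> make the family closed under differentiation: the derivative of
  \<open>flat k\<close> is a combination of \<open>flat (k + 1)\<close> and \<open>flat (k + 2)\<close>, so that smoothness needs no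
  formula for higher derivatives.\<close>

definition flat :: "nat \<Rightarrow> real \<Rightarrow> real" where
  "flat k t = (if t > 0 then exp (- 1 / t) / t ^ k else 0)"

text \<open>The only delicate point is \<open>t = 0\<close>, where the difference quotient from the right is
  \<open>s\<^sup>k\<^sup>+\<^sup>1 / exp s\<close> with \<open>s = 1 / t\<close> tending to infinity.\<close>

lemma DERIV_flat:
  "(flat k has_real_derivative (flat (k + 2) t - real k * flat (k + 1) t)) (at t)"
proof -
  consider "t > 0" | "t < 0" | "t = 0" by linarith
  then show ?thesis
  proof cases
    case 1
    let ?s = "inverse t"
    have "((\<lambda>t. exp (- inverse t) * inverse t ^ k) has_real_derivative
        exp (- ?s) * ?s ^ (k + 2) - real k * (exp (- ?s) * ?s ^ (k + 1))) (at t)"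
    proof (cases k)
      case 0
      then show ?thesis
        using 1 by (auto intro!: derivative_eq_intros simp: power2_eq_square)
    next
      case (Suc n)
      have "n = 0 \<or> ?s ^ n = ?s * ?s ^ (n - Suc 0)" by (cases n) auto
      with Suc 1 show ?thesis
        by - (rule derivative_eq_intros refl | simp)+
    qed
    also have "exp (- ?s) * ?s ^ (k + 2) - real k * (exp (- ?s) * ?s ^ (k + 1))
        = flat (k + 2) t - real k * flat (k + 1) t"
      using 1 by (simp add: flat_def inverse_eq_divide power_divide)
    finally show ?thesis
      by (rule has_field_derivative_transform_within_open[where S = "{0<..}"])
        (use 1 in \<open>auto simp: flat_def inverse_eq_divide power_divide\<close>)
  next
    case 2
    have "((\<lambda>t. 0) has_real_derivative (flat (k + 2) t - real k * flat (k + 1) t)) (at t)"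
      using 2 by (auto simp: flat_def)
    then show ?thesis
      by (rule has_field_derivative_transform_within_open[where S = "{..<0}"])
        (use 2 in \<open>auto simp: flat_def\<close>)
  next
    case 3
    have "((\<lambda>h. flat k h / h) \<longlongrightarrow> 0) (at_right 0)"
    proof (rule Lim_transform_eventually)
      show "((\<lambda>h. (inverse h) ^ (k + 1) / exp (inverse h)) \<longlongrightarrow> 0) (at_right (0::real))"
        by (rule filterlim_compose[OF tendsto_power_div_exp_0 filterlim_inverse_at_top_right])
      show "\<forall>\<^sub>F h in at_right 0. inverse h ^ (k + 1) / exp (inverse h) = flat k h / h"
        using eventually_at_right_less[of 0]
        by eventually_elim (simp add: flat_def exp_minus field_simps)
    qed
    moreover have "((\<lambda>h. flat k h / h) \<longlongrightarrow> 0) (at_left 0)"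
    proof (rule Lim_transform_eventually)
      show "((\<lambda>h. 0) \<longlongrightarrow> (0::real)) (at_left (0::real))" by simp
      have "\<forall>\<^sub>F h in at_left 0. h < (0::real)"
        by (simp add: eventually_at_filter)
      then show "\<forall>\<^sub>F h in at_left 0. 0 = flat k h / h"
        by eventually_elim (simp add: flat_def)
    qed
    ultimately have "((\<lambda>h. flat k h / h) \<longlongrightarrow> 0) (at 0)"
      by (simp add: filterlim_at_split)
    then show ?thesis
      using 3 by (simp add: DERIV_def flat_def)
  qed
qed

text \<open>The algebra generated by the ridge functions \<open>x \<mapsto> flat k (x \<bullet> e + c)\<close>. It is stable under
  directional derivatives, which turns smoothness of all its members into a single induction over
  the generators, instead of a computation with iterated derivatives.\<close>

inductive_set bump_algebra :: "('a::euclidean_space \<Rightarrow> complex) set" where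
  ridge: "(\<lambda>x. of_real (flat k (x \<bullet> e + c))) \<in> bump_algebra"
| const: "(\<lambda>x. c) \<in> bump_algebra"
| add: "f \<in> bump_algebra \<Longrightarrow> g \<in> bump_algebra \<Longrightarrow> (\<lambda>x. f x + g x) \<in> bump_algebra"
| mult: "f \<in> bump_algebra \<Longrightarrow> g \<in> bump_algebra \<Longrightarrow> (\<lambda>x. f x * g x) \<in> bump_algebra"

lemma bump_algebra_derivative:
  assumes "f \<in> bump_algebra"
  shows "\<exists>D. (\<forall>x. (f has_derivative D x) (at x)) \<and> (\<forall>b. (\<lambda>x. D x b) \<in> bump_algebra)"
  using assms
proof induction
  case (ridge k e c)
  let ?d = "\<lambda>t. flat (k + 2) t - real k * flat (k + 1) t"
  let ?D = "\<lambda>x b. complex_of_real (?d (x \<bullet> e + c) * (b \<bullet> e))"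
  have "((\<lambda>x. complex_of_real (flat k (x \<bullet> e + c))) has_derivative ?D x) (at x)" for x
  proof -
    have "((\<lambda>x. x \<bullet> e + c) has_derivative (\<lambda>b. b \<bullet> e)) (at x)"
      by (auto intro!: derivative_eq_intros)
    then have "((\<lambda>x. flat k (x \<bullet> e + c)) has_derivative (\<lambda>b. ?d (x \<bullet> e + c) * (b \<bullet> e))) (at x)"
      using DERIV_compose_FDERIV[OF DERIV_flat] by (simp add: mult.commute)
    then show ?thesis
      by (rule has_derivative_of_real)
  qed
  moreover have "(\<lambda>x. ?D x b) \<in> bump_algebra" for b
  proof -
    have "(\<lambda>x. (complex_of_real (flat (k + 2) (x \<bullet> e + c)) +
          of_real (- real k) * of_real (flat (k + 1) (x \<bullet> e + c))) * of_real (b \<bullet> e)) \<in> bump_algebra"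
      by (intro bump_algebra.intros)
    then show ?thesis by (simp add: algebra_simps)
  qed
  ultimately show ?case by (intro exI[of _ ?D]) blast
next
  case (const c)
  have "(\<lambda>x. 0) \<in> bump_algebra" by (rule bump_algebra.const)
  then show ?case by (intro exI[of _ "\<lambda>x b. 0"]) auto
next
  case (add f g)
  then obtain D E where D: "\<forall>x. (f has_derivative D x) (at x)" "\<forall>b. (\<lambda>x. D x b) \<in> bump_algebra"
    and E: "\<forall>x. (g has_derivative E x) (at x)" "\<forall>b. (\<lambda>x. E x b) \<in> bump_algebra" by blast
  then show ?case
    by (intro exI[of _ "\<lambda>x b. D x b + E x b"])
      (auto intro!: has_derivative_add bump_algebra.add)
next
  case (mult f g)
  then obtain D E where D: "\<forall>x. (f has_derivative D x) (at x)" "\<forall>b. (\<lambda>x. D x b) \<in> bump_algebra"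
    and E: "\<forall>x. (g has_derivative E x) (at x)" "\<forall>b. (\<lambda>x. E x b) \<in> bump_algebra" by blast
  then show ?case
    using mult.hyps
    by (intro exI[of _ "\<lambda>x b. f x * E x b + D x b * g x"])
      (auto intro!: has_derivative_mult bump_algebra.add bump_algebra.mult)
qed

lemma bump_algebra_smooth:
  assumes "f \<in> bump_algebra"
  shows "smooth_on UNIV f"
proof -
  have "iter_deriv bs f \<in> bump_algebra" for bs
  proof (induction bs)
    case Nil
    then show ?case using assms by simp
  next
    case (Cons b bs)
    then obtain D where "\<forall>x. (iter_deriv bs f has_derivative D x) (at x)"
      and *: "\<forall>b. (\<lambda>x. D x b) \<in> bump_algebra"
      using bump_algebra_derivative by blast
    then have "frechet_derivative (iter_deriv bs f) (at x) = D x" for x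
      using frechet_derivative_at[of "iter_deriv bs f" "D x" x] by simp
    then show ?case using * by simp
  qed
  then show ?thesis
    using bump_algebra_derivative unfolding smooth_on_def differentiable_def by blast
qed

lemma smooth_on_iter_deriv_continuous:
  assumes "smooth_on UNIV f"
  shows "continuous_on UNIV (iter_deriv bs f)"
  using assms unfolding smooth_on_def
  by (simp add: continuous_on_eq_continuous_at differentiable_imp_continuous_within)

lemma bump_algebra_prod:
  assumes "finite I" "\<And>i. i \<in> I \<Longrightarrow> f i \<in> bump_algebra"
  shows "(\<lambda>x. \<Prod>i\<in>I. f i x) \<in> bump_algebra"
  using assms by (induction I rule: finite_induct) (auto intro: bump_algebra.intros)

text \<open>Since \<open>flat 0 s\<close> tends to 1 for \<open>s\<close> tending to infinity, stretching the arguments by \<open>n + 1\<close>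
  makes these bumps fill the box while their supports stay inside the closed box. Their limit is the
  indicator function of the open box.\<close>

definition box_bump :: "'a::euclidean_space \<Rightarrow> 'a \<Rightarrow> nat \<Rightarrow> 'a \<Rightarrow> complex" where
  "box_bump a b n x = (\<Prod>e\<in>Basis. of_real (flat 0 (real (Suc n) * (x \<bullet> e - a \<bullet> e)))
                                  * of_real (flat 0 (real (Suc n) * (b \<bullet> e - x \<bullet> e))))"

lemma flat_0_bounds: "0 \<le> flat 0 t" "flat 0 t \<le> 1"
  by (auto simp: flat_def)

lemma box_bump_nonzero_iff: "box_bump a b n x \<noteq> 0 \<longleftrightarrow> x \<in> box a b"
  unfolding box_bump_def prod_zero_iff[OF finite_Basis] mem_box
  by (auto simp: flat_def zero_less_mult_iff)

lemma test_function_box_bump: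
  assumes "cbox a b \<subseteq> Q"
  shows "test_function Q (box_bump a b n)"
proof -
  have "box_bump a b n \<in> bump_algebra"
  proof -
    let ?m = "real (Suc n)"
    have "(\<lambda>x. \<Prod>e\<in>Basis. complex_of_real (flat 0 (x \<bullet> (?m *\<^sub>R e) + - (?m * (a \<bullet> e))))
           * of_real (flat 0 (x \<bullet> ((- ?m) *\<^sub>R e) + ?m * (b \<bullet> e)))) \<in> bump_algebra"
      by (intro bump_algebra_prod bump_algebra.intros finite_Basis)
    moreover have "(\<lambda>x. \<Prod>e\<in>Basis. complex_of_real (flat 0 (x \<bullet> (?m *\<^sub>R e) + - (?m * (a \<bullet> e))))
           * of_real (flat 0 (x \<bullet> ((- ?m) *\<^sub>R e) + ?m * (b \<bullet> e)))) = box_bump a b n"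
      unfolding box_bump_def[abs_def]
      by (intro ext prod.cong arg_cong2[where f = "(*)"] arg_cong[where f = complex_of_real]
          arg_cong[where f = "flat 0"]) (auto simp only: inner_scaleR_right algebra_simps)
    ultimately show ?thesis by simp
  qed
  moreover have "closure {x. box_bump a b n x \<noteq> 0} \<subseteq> cbox a b"
    unfolding box_bump_nonzero_iff using box_subset_cbox by (intro closure_minimal) auto
  moreover then have "compact (closure {x. box_bump a b n x \<noteq> 0})"
    using bounded_subset[OF bounded_cbox] by (auto simp: compact_eq_bounded_closed)
  ultimately show ?thesis
    using assms unfolding test_function_def by (auto intro: bump_algebra_smooth)
qed

lemma norm_box_bump_le: "norm (box_bump a b n x) \<le> 1"
  unfolding box_bump_def prod_norm[symmetric]
  by (intro prod_le_1) (auto simp: norm_mult flat_0_bounds intro!: mult_le_one)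

lemma box_bump_tendsto: "(\<lambda>n. box_bump a b n x) \<longlonglongrightarrow> indicator (box a b) x"
proof (cases "x \<in> box a b")
  case False
  then have "box_bump a b n x = 0" for n using box_bump_nonzero_iff[of a b n x] by simp
  then show ?thesis using False by simp
next
  case True
  have flat_lim: "(\<lambda>n. flat 0 (real (Suc n) * t)) \<longlonglongrightarrow> 1" if "t > 0" for t
  proof -
    have "(\<lambda>n. exp (- (inverse t * inverse (real (Suc n))))) \<longlonglongrightarrow> exp (- (inverse t * 0))"
      by (intro tendsto_intros LIMSEQ_inverse_real_of_nat)
    moreover have "exp (- (inverse t * inverse (real (Suc n)))) = flat 0 (real (Suc n) * t)" for n
      using that by (simp add: flat_def zero_less_mult_iff inverse_eq_divide mult.commute)
    ultimately show ?thesis by simp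
  qed
  have "(\<lambda>n. box_bump a b n x) \<longlonglongrightarrow> (\<Prod>e\<in>(Basis::'a set). of_real 1 * of_real 1)"
    unfolding box_bump_def using True
    by (intro tendsto_prod tendsto_mult tendsto_of_real flat_lim) (auto simp: mem_box)
  then show ?thesis using True by simp
qed

text \<open>Dominated convergence along the bumps of the box, each of which is orthogonal to \<open>g\<close>.\<close>

lemma integral_box_eq_0_if_orthogonal_to_test_functions:
  fixes g :: "'a::euclidean_space \<Rightarrow> complex"
  assumes Q: "Q \<in> sets lebesgue"
    and g: "integrable (lebesgue_on Q) g"
    and orth: "\<And>\<phi>. test_function Q \<phi> \<Longrightarrow> L2_ip Q g \<phi> = 0"
    and ab: "cbox a b \<subseteq> Q"
  shows "(LINT x|lebesgue. indicator (box a b) x *\<^sub>R g x) = 0"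
proof -
  have gQ: "integrable lebesgue (\<lambda>x. indicator Q x *\<^sub>R g x)"
    using g Q by (simp add: integrable_restrict_space set_integrable_def)
  let ?s = "\<lambda>n x. (indicator Q x *\<^sub>R g x) * cnj (box_bump a b n x)"
  have meas: "box_bump a b n \<in> borel_measurable lebesgue" for n
  proof -
    have "smooth_on UNIV (box_bump a b n)"
      using test_function_box_bump[of a b UNIV n] by (auto simp: test_function_def)
    then have "box_bump a b n differentiable (at x)" for x
      unfolding smooth_on_def by (metis UNIV_I iter_deriv.simps(1))
    then have "continuous_on UNIV (box_bump a b n)"
      by (simp add: continuous_on_eq_continuous_at differentiable_imp_continuous_within)
    then show ?thesis
      by (intro measurable_completion) (simp add: borel_measurable_continuous_onI)
  qed
  have meas': "(\<lambda>x. cnj (box_bump a b n x)) \<in> borel_measurable lebesgue" for n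
    by (rule measurable_compose[OF meas])
      (intro borel_measurable_continuous_onI continuous_intros)
  have "(\<lambda>n. LINT x|lebesgue. ?s n x) \<longlonglongrightarrow> (LINT x|lebesgue. indicator (box a b) x *\<^sub>R g x)"
  proof (rule integral_dominated_convergence[where w = "\<lambda>x. norm (indicator Q x *\<^sub>R g x)"])
    show "(\<lambda>x. indicat_real (box a b) x *\<^sub>R g x) \<in> borel_measurable lebesgue"
    proof -
      have "(\<lambda>x. indicat_real (box a b) x *\<^sub>R (indicat_real Q x *\<^sub>R g x)) \<in> borel_measurable lebesgue"
        by (intro borel_measurable_integrable integrable_mult_indicator gQ) simp
      moreover have "(\<lambda>x. indicat_real (box a b) x *\<^sub>R (indicat_real Q x *\<^sub>R g x))
          = (\<lambda>x. indicat_real (box a b) x *\<^sub>R g x)"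
        using ab box_subset_cbox[of a b] by (auto simp: indicator_def fun_eq_iff)
      ultimately show ?thesis by simp
    qed
    show "?s n \<in> borel_measurable lebesgue" for n
      using borel_measurable_integrable[OF gQ] meas' by (intro borel_measurable_times)
    show "integrable lebesgue (\<lambda>x. norm (indicat_real Q x *\<^sub>R g x))"
      using gQ by (rule integrable_norm)
    show "AE x in lebesgue. (\<lambda>n. ?s n x) \<longlonglongrightarrow> indicator (box a b) x *\<^sub>R g x"
    proof (rule AE_I2)
      fix x
      have "(\<lambda>n. ?s n x) \<longlonglongrightarrow> (indicator Q x *\<^sub>R g x) * cnj (indicator (box a b) x)"
        by (intro tendsto_intros box_bump_tendsto)
      also have "(indicator Q x *\<^sub>R g x) * cnj (indicator (box a b) x) = indicator (box a b) x *\<^sub>R g x"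
        using ab box_subset_cbox[of a b] by (auto simp: indicator_def)
      finally show "(\<lambda>n. ?s n x) \<longlonglongrightarrow> indicator (box a b) x *\<^sub>R g x" .
    qed
    show "AE x in lebesgue. norm (?s n x) \<le> norm (indicat_real Q x *\<^sub>R g x)" for n
    proof (rule AE_I2)
      fix x
      have "norm (?s n x) \<le> norm (indicat_real Q x *\<^sub>R g x) * 1"
        unfolding norm_mult complex_mod_cnj
        by (intro mult_left_mono norm_box_bump_le) auto
      then show "norm (?s n x) \<le> norm (indicat_real Q x *\<^sub>R g x)" by simp
    qed
  qed
  moreover have "(LINT x|lebesgue. ?s n x) = L2_ip Q g (box_bump a b n)" for n
    unfolding L2_ip_def using Q by (subst integral_restrict_space) auto
  moreover have "L2_ip Q g (box_bump a b n) = 0" for n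
    by (intro orth test_function_box_bump ab)
  ultimately have "(\<lambda>n. 0) \<longlonglongrightarrow> (LINT x|lebesgue. indicator (box a b) x *\<^sub>R g x)" by simp
  then show ?thesis using LIMSEQ_const_iff by metis
qed

text \<open>Boxes form an intersection-stable generator of the Borel sets, and the sets over which \<open>g\<close> has
  integral zero are closed under complements and disjoint unions. The complement step is the reason
  for the hypothesis on the integral over the whole space. Lebesgue sets differ from Borel sets by
  null sets only.\<close>

lemma set_integral_eq_0_if_box_integrals_eq_0:
  fixes g :: "'a::euclidean_space \<Rightarrow> complex"
  assumes g: "integrable lebesgue g"
    and UNIV0: "(LINT x|lebesgue. g x) = 0"
    and boxes: "\<And>c d. (LINT x|lebesgue. indicator (box c d) x *\<^sub>R g x) = 0"
    and A: "A \<in> sets lebesgue"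
  shows "(LINT x:A|lebesgue. g x) = 0"
proof -
  have borel0: "(LINT x:B|lebesgue. g x) = 0" if "B \<in> sets borel" for B
  proof -
    have "Int_stable (range (\<lambda>(a, b). box a b :: 'a set))"
      by (auto simp: Int_stable_def box_Int_box)
    moreover have "range (\<lambda>(a, b). box a b :: 'a set) \<subseteq> Pow UNIV" by simp
    moreover have "B \<in> sigma_sets UNIV (range (\<lambda>(a, b). box a b))"
      using that unfolding borel_eq_box by simp
    ultimately show ?thesis
    proof (induction rule: sigma_sets_induct_disjoint)
      case (basic B)
      then show ?case using boxes by (auto simp: set_lebesgue_integral_def)
    next
      case empty
      then show ?case by (simp add: set_lebesgue_integral_def)
    next
      case (compl B)
      then have B: "B \<in> sets lebesgue" by (simp add: borel_eq_box)
      have "(LINT x:UNIV - B|lebesgue. g x) = (LINT x|lebesgue. g x - indicator B x *\<^sub>R g x)"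
        unfolding set_lebesgue_integral_def
        by (intro Bochner_Integration.integral_cong) (auto simp: indicator_def)
      also have "\<dots> = (LINT x|lebesgue. g x) - (LINT x:B|lebesgue. g x)"
        unfolding set_lebesgue_integral_def
        using g B by (intro Bochner_Integration.integral_diff integrable_mult_indicator)
      finally show ?case using compl UNIV0 by simp
    next
      case (union B)
      have "B i \<in> sets borel" for i
        using union(2) unfolding borel_eq_box by auto
      then have B: "B i \<in> sets lebesgue" for i by simp
      then have "set_integrable lebesgue (\<Union>i. B i) g"
        unfolding set_integrable_def using g by (intro integrable_mult_indicator) auto
      then have "(LINT x:(\<Union>i. B i)|lebesgue. g x) = (\<Sum>i. (LINT x:B i|lebesgue. g x))"
        using B union(1) by (intro lebesgue_integral_countable_add) (auto simp: disjoint_family_on_def)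
      then show ?case using union by simp
    qed
  qed
  have "(LINT x:A|lebesgue. g x) = (LINT x:main_part lborel A|lebesgue. g x)"
    unfolding set_lebesgue_integral_def
  proof (rule integral_cong_AE)
    obtain N where N: "N \<in> null_sets lborel" "null_part lborel A \<subseteq> N"
      using null_part[OF A] by auto
    have "AE x in lebesgue. x \<notin> N"
      using N(1) by (intro AE_not_in null_sets_completionI)
    moreover have "x \<in> A \<longleftrightarrow> x \<in> main_part lborel A" if "x \<notin> N" for x
      using main_part_null_part_Un[OF A] N(2) that by blast
    ultimately show "AE x in lebesgue. indicat_real A x *\<^sub>R g x = indicat_real (main_part lborel A) x *\<^sub>R g x"
      by (auto simp: indicator_def elim!: eventually_mono)
    show "(\<lambda>x. indicat_real A x *\<^sub>R g x) \<in> borel_measurable lebesgue"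
      using A g by (intro borel_measurable_integrable integrable_mult_indicator)
    show "(\<lambda>x. indicat_real (main_part lborel A) x *\<^sub>R g x) \<in> borel_measurable lebesgue"
      using main_part_sets[OF A] g by (intro borel_measurable_integrable integrable_mult_indicator) auto
  qed
  also have "\<dots> = 0"
    using main_part_sets[OF A] by (intro borel0) simp
  finally show ?thesis .
qed

lemma sigma_finite_lebesgue: "sigma_finite_measure (lebesgue :: 'a::euclidean_space measure)"
proof -
  obtain A :: "'a set set" where "countable A" "A \<subseteq> sets lborel" "\<Union>A = space lborel"
    "\<forall>a\<in>A. emeasure lborel a \<noteq> \<infinity>"
    using lborel.sigma_finite_countable by blast
  then show ?thesis
    by unfold_locales (intro exI[of _ A], auto simp: subset_eq)
qed

text \<open>The fundamental lemma of the calculus of variations. The argument is local: \<open>g\<close> is cut off to a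
  box whose closure lies in \<open>Q\<close>, so that all integrals over the whole space are integrals over boxes
  again, and countably many such boxes cover \<open>Q\<close>.\<close>

lemma AE_eq_0_if_orthogonal_to_test_functions:
  fixes g :: "'a::euclidean_space \<Rightarrow> complex"
  assumes Q: "open Q" and g: "integrable (lebesgue_on Q) g"
    and orth: "\<And>\<phi>. test_function Q \<phi> \<Longrightarrow> L2_ip Q g \<phi> = 0"
  shows "AE x in lebesgue_on Q. g x = 0"
proof -
  have QL: "Q \<in> sets lebesgue" using Q by simp
  have gQ: "integrable lebesgue (\<lambda>x. indicator Q x *\<^sub>R g x)"
    using g QL by (simp add: integrable_restrict_space set_integrable_def)
  have box0: "AE x in lebesgue. x \<in> box a b \<longrightarrow> g x = 0" if ab: "cbox a b \<subseteq> Q" for a b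
  proof -
    let ?h = "\<lambda>x. indicat_real (box a b) x *\<^sub>R g x"
    have sub: "box a b \<subseteq> Q" using ab box_subset_cbox by blast
    have "integrable lebesgue (\<lambda>x. indicat_real (box a b) x *\<^sub>R (indicator Q x *\<^sub>R g x))"
      by (rule integrable_mult_indicator[OF _ gQ]) simp
    also have "(\<lambda>x. indicat_real (box a b) x *\<^sub>R (indicator Q x *\<^sub>R g x)) = ?h"
      using sub by (auto simp: indicator_def fun_eq_iff)
    finally have h: "integrable lebesgue ?h" .
    have zero: "(LINT x|lebesgue. indicator (box c d) x *\<^sub>R g x) = 0" if "box c d \<subseteq> box a b" for c d
    proof (cases "box c d = {}")
      case False
      then have "cbox c d \<subseteq> cbox a b"
        using closure_mono[OF that] False that
        by (metis closure_box subset_empty)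
      then show ?thesis using ab by (intro integral_box_eq_0_if_orthogonal_to_test_functions[OF QL g orth]) auto
    qed simp
    have "(LINT x:A|lebesgue. ?h x) = 0" if "A \<in> sets lebesgue" for A
    proof (rule set_integral_eq_0_if_box_integrals_eq_0[OF h _ _ that])
      show "(LINT x|lebesgue. ?h x) = 0" by (rule zero) simp
      fix c d
      obtain c' d' where *: "box c d \<inter> box a b = box c' d'"
        using box_Int_box[of c d a b] by blast
      have "(LINT x|lebesgue. indicat_real (box c d) x *\<^sub>R ?h x)
          = (LINT x|lebesgue. indicator (box c' d') x *\<^sub>R g x)"
        unfolding *[symmetric] by (simp add: indicator_inter_arith)
      also have "\<dots> = 0" using * by (intro zero) auto
      finally show "(LINT x|lebesgue. indicat_real (box c d) x *\<^sub>R ?h x) = 0" .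
    qed
    then have "AE x in lebesgue. ?h x = 0" using h by (intro sigma_finite_measure.density_zero[OF sigma_finite_lebesgue])
    then show ?thesis by eventually_elim (auto simp: indicator_def)
  qed
  obtain \<D> where D: "countable \<D>" "\<And>X. X \<in> \<D> \<Longrightarrow> \<exists>a b. X = box a b \<and> cbox a b \<subseteq> Q" "\<Union>\<D> = Q"
  proof -
    let ?F = "{box a b |a b. cbox a b \<subseteq> Q}"
    have "\<Union>?F = Q"
    proof
      show "\<Union>?F \<subseteq> Q" using box_subset_cbox by blast
      show "Q \<subseteq> \<Union>?F"
      proof
        fix x assume "x \<in> Q"
        with Q obtain a b where "cbox a b \<subseteq> Q" "x \<in> box a b"
          by (rule open_contains_cbox)
        then show "x \<in> \<Union>?F" by blast
      qed
    qed
    moreover obtain \<D> where "\<D> \<subseteq> ?F" "countable \<D>" "\<Union>\<D> = \<Union>?F"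
      using Lindelof[of ?F] by auto
    ultimately show thesis by (intro that[of \<D>]) auto
  qed
  have "AE x in lebesgue. x \<in> X \<longrightarrow> g x = 0" if X: "X \<in> \<D>" for X
  proof -
    from D(2)[OF X] obtain a b where "X = box a b" "cbox a b \<subseteq> Q" by blast
    then show ?thesis using box0[of a b] by simp
  qed
  then have "AE x in lebesgue. \<forall>X\<in>\<D>. x \<in> X \<longrightarrow> g x = 0"
    by (rule AE_ball_countable[OF D(1), THEN iffD2, OF ballI])
  then have "AE x in lebesgue. x \<in> Q \<longrightarrow> g x = 0"
    using D(3) by (auto elim!: eventually_mono)
  then show ?thesis
    using QL by (subst AE_restrict_space_iff) auto
qed

section \<open>The graph space of the Schroedinger operator\<close>

locale schroedinger_cylinder =
  fixes \<nu> T :: real and \<Omega> :: "(real^'d) set"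
  assumes open_Omega: "open \<Omega>" and bounded_Omega: "bounded \<Omega>"
begin

abbreviation "Q \<equiv> cylinder T \<Omega>"
abbreviation "S \<equiv> S_op \<nu> Q"
abbreviation "V \<equiv> V_space \<nu> T \<Omega>"

lemma open_Q: "open Q"
  unfolding cylinder_def by (intro open_Times open_Omega) auto

lemma bounded_Q: "bounded Q"
  unfolding cylinder_def by (intro bounded_Times bounded_Omega) auto

lemma Q_lebesgue: "Q \<in> sets lebesgue"
  using open_Q by simp

lemma integrable_L2:
  assumes "g \<in> L2 Q"
  shows "integrable (lebesgue_on Q) g"
  by (rule L2_imp_integrable[OF assms bounded_set_imp_lmeasurable[OF bounded_Q Q_lebesgue]])

lemma test_function_L2: "test_function U w \<Longrightarrow> w \<in> L2 Q"
  using smooth_on_iter_deriv_continuous[of w "[]"]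
  by (intro continuous_imp_L2 bounded_Q Q_lebesgue) (simp add: test_function_def)

lemma schroedinger_test_function_L2:
  assumes "test_function U w"
  shows "schroedinger \<nu> w \<in> L2 Q"
proof -
  have "continuous_on UNIV (iter_deriv bs w)" for bs
    using assms by (intro smooth_on_iter_deriv_continuous) (simp add: test_function_def)
  then have "continuous_on UNIV (schroedinger \<nu> w)"
    unfolding schroedinger_def by (intro continuous_intros)
  then show ?thesis by (rule continuous_imp_L2[OF _ bounded_Q Q_lebesgue])
qed

text \<open>By the fundamental lemma, \<open>S_op \<nu> Q v\<close>, although defined by choice, is determined up to null sets
  when \<open>v\<close> has a weak image in \<open>L2 Q\<close>. This makes it linear almost everywhere, which the
  estimates below rely on.\<close>

lemma weak_schroedinger_unique:
  assumes "g \<in> L2 Q" "g' \<in> L2 Q" "weak_schroedinger \<nu> Q v g" "weak_schroedinger \<nu> Q v g'"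
  shows "AE p in lebesgue_on Q. g p = g' p"
proof -
  have "L2_ip Q (\<lambda>p. g p - g' p) \<phi> = 0" if "test_function Q \<phi>" for \<phi>
  proof -
    have "L2_ip Q g \<phi> = L2_ip Q g' \<phi>"
      using assms(3,4) that unfolding weak_schroedinger_def by metis
    then show ?thesis
      using L2_ip_diff_left[OF assms(1,2) test_function_L2[OF that]] by simp
  qed
  then have "AE p in lebesgue_on Q. g p - g' p = 0"
    by (rule AE_eq_0_if_orthogonal_to_test_functions[OF open_Q integrable_L2[OF L2_diff[OF assms(1,2)]]])
  then show ?thesis by eventually_elim simp
qed

lemma S_op_eq_AE:
  assumes "g \<in> L2 Q" "weak_schroedinger \<nu> Q v g"
  shows "S v \<in> L2 Q" "weak_schroedinger \<nu> Q v (S v)" "AE p in lebesgue_on Q. S v p = g p"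
proof -
  have *: "S v \<in> L2 Q \<and> weak_schroedinger \<nu> Q v (S v)"
    unfolding S_op_def by (rule someI[of _ g]) (rule conjI[OF assms])
  from * show "S v \<in> L2 Q" "weak_schroedinger \<nu> Q v (S v)" by (rule conjunct1, rule conjunct2)
  show "AE p in lebesgue_on Q. S v p = g p"
    by (rule weak_schroedinger_unique[OF conjunct1[OF *] assms(1) conjunct2[OF *] assms(2)])
qed

lemma V_D:
  assumes "v \<in> V"
  shows "v \<in> L2 Q" "S v \<in> L2 Q" "weak_schroedinger \<nu> Q v (S v)"
    "\<And>w. test_function UNIV w \<Longrightarrow> \<forall>p \<in> {0<..<T} \<times> frontier \<Omega> \<union> {T} \<times> \<Omega>. w p = 0 \<Longrightarrow>
       L2_ip Q (schroedinger \<nu> w) v = L2_ip Q w (S v)"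
proof -
  from assms obtain g where g: "v \<in> L2 Q" "g \<in> L2 Q" "weak_schroedinger \<nu> Q v g"
    unfolding V_space_def by blast
  show "v \<in> L2 Q" "S v \<in> L2 Q" "weak_schroedinger \<nu> Q v (S v)"
    using g(1) S_op_eq_AE(1,2)[OF g(2,3)] .
  have adj: "\<forall>w. test_function UNIV w \<longrightarrow> (\<forall>p \<in> {0<..<T} \<times> frontier \<Omega> \<union> {T} \<times> \<Omega>. w p = 0) \<longrightarrow>
      L2_ip Q (schroedinger \<nu> w) v - L2_ip Q w (S v) = 0"
    using assms unfolding V_space_def by blast
  show "L2_ip Q (schroedinger \<nu> w) v = L2_ip Q w (S v)"
    if "test_function UNIV w" "\<forall>p \<in> {0<..<T} \<times> frontier \<Omega> \<union> {T} \<times> \<Omega>. w p = 0" for w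
    using adj[rule_format, OF that(1)] that(2) by simp
qed

text \<open>The adjoint relation may be checked with any representative \<open>g\<close> of the weak image instead of the
  chosen one; the linearity of the space then reduces to that of the weak formulation.\<close>

lemma V_I:
  assumes v: "v \<in> L2 Q" and g: "g \<in> L2 Q" "weak_schroedinger \<nu> Q v g"
    and adj: "\<And>w. test_function UNIV w \<Longrightarrow> \<forall>p \<in> {0<..<T} \<times> frontier \<Omega> \<union> {T} \<times> \<Omega>. w p = 0 \<Longrightarrow>
       L2_ip Q (schroedinger \<nu> w) v = L2_ip Q w g"
  shows "v \<in> V"
proof -
  note S = S_op_eq_AE[OF g]
  have "L2_ip Q w (S v) = L2_ip Q w g" if "test_function UNIV w" for w
    by (rule L2_ip_cong_AE[OF _ S(3) test_function_L2[OF that] test_function_L2[OF that] S(1) g(1)]) simp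
  then have "\<forall>w. test_function UNIV w \<longrightarrow> (\<forall>p \<in> {0<..<T} \<times> frontier \<Omega> \<union> {T} \<times> \<Omega>. w p = 0) \<longrightarrow>
      L2_ip Q (schroedinger \<nu> w) v - L2_ip Q w (S v) = 0"
    using adj by simp
  then show ?thesis
    using v g unfolding V_space_def by blast
qed

lemma V_add:
  assumes u: "u \<in> V" and v: "v \<in> V"
  shows "(\<lambda>p. u p + v p) \<in> V" "AE p in lebesgue_on Q. S (\<lambda>p. u p + v p) p = S u p + S v p"
proof -
  note D = V_D[OF u] V_D[OF v]
  have g: "(\<lambda>p. S u p + S v p) \<in> L2 Q" using D by (intro L2_add)
  have w: "weak_schroedinger \<nu> Q (\<lambda>p. u p + v p) (\<lambda>p. S u p + S v p)"
    using D unfolding weak_schroedinger_def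
    by (auto simp: L2_ip_add_left schroedinger_test_function_L2 test_function_L2)
  show "(\<lambda>p. u p + v p) \<in> V"
    using D by (intro V_I[OF _ g w] L2_add)
      (auto simp: L2_ip_add_right schroedinger_test_function_L2 test_function_L2)
  show "AE p in lebesgue_on Q. S (\<lambda>p. u p + v p) p = S u p + S v p"
    by (rule S_op_eq_AE(3)[OF g w])
qed

lemma V_scale:
  assumes v: "v \<in> V"
  shows "(\<lambda>p. c * v p) \<in> V" "AE p in lebesgue_on Q. S (\<lambda>p. c * v p) p = c * S v p"
proof -
  note D = V_D[OF v]
  have g: "(\<lambda>p. c * S v p) \<in> L2 Q" using D by (intro L2_scale)
  have w: "weak_schroedinger \<nu> Q (\<lambda>p. c * v p) (\<lambda>p. c * S v p)"
    using D unfolding weak_schroedinger_def by (auto simp: L2_ip_scale_left)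
  show "(\<lambda>p. c * v p) \<in> V"
    using D by (intro V_I[OF _ g w] L2_scale) (auto simp: L2_ip_scale_right)
  show "AE p in lebesgue_on Q. S (\<lambda>p. c * v p) p = c * S v p"
    by (rule S_op_eq_AE(3)[OF g w])
qed

lemma V_diff:
  assumes u: "u \<in> V" and v: "v \<in> V"
  shows "(\<lambda>p. u p - v p) \<in> V" "AE p in lebesgue_on Q. S (\<lambda>p. u p - v p) p = S u p - S v p"
proof -
  have *: "(\<lambda>p. u p - v p) = (\<lambda>p. u p + (- 1) * v p)" by simp
  show "(\<lambda>p. u p - v p) \<in> V"
    unfolding * by (intro V_add(1) u V_scale(1) v)
  show "AE p in lebesgue_on Q. S (\<lambda>p. u p - v p) p = S u p - S v p"
    unfolding * using V_add(2)[OF u V_scale(1)[OF v, of "- 1"]] V_scale(2)[OF v, of "- 1"]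
    by eventually_elim simp
qed

lemma V_zero: "(\<lambda>p. 0) \<in> V"
  by (rule V_I[where g = "\<lambda>p. 0"])
    (auto simp: L2_zero weak_schroedinger_def L2_ip_def)

lemma A_form_eq_ip: "A_form \<nu> T \<Omega> v w = L2_ip Q (S v) w"
  by (simp add: A_form_def L2_ip_def)

lemma F_form_eq_ip: "F_form T \<Omega> f w = L2_ip Q f w"
  by (simp add: F_form_def L2_ip_def)

end

section \<open>B-splines at the ends of the interval\<close>

lemma downward_closed_eq_lessThan_card:
  fixes A :: "nat set"
  assumes "finite A" "\<And>i j. i \<in> A \<Longrightarrow> j < i \<Longrightarrow> j \<in> A"
  shows "A = {..<card A}"
proof (cases "A = {}")
  case False
  have "A = {..Max A}"
  proof
    show "{..Max A} \<subseteq> A"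
      using assms(2) Max_in[OF assms(1) False] by (auto simp: le_less)
  qed (use assms(1) in auto)
  then have "A = {..<Suc (Max A)}" by (simp add: lessThan_Suc_atMost)
  then show ?thesis by (metis card_lessThan)
qed simp

lemma count_list_eq_card: "count_list xs x = card {i. i < length xs \<and> xs ! i = x}"
  by (simp add: count_list_eq_length_filter length_filter_conv_card eq_commute)

text \<open>In a sorted list the indices of the least value form an initial segment and those of the largest
  value a final one, so the multiplicities fix their positions.\<close>

lemma open_knot_vector_nth:
  assumes "open_knot_vector p \<Xi>"
  shows "2 * p + 2 \<le> length \<Xi>"
    and "i < length \<Xi> \<Longrightarrow> \<Xi> ! i = 0 \<longleftrightarrow> i \<le> p"
    and "i < length \<Xi> \<Longrightarrow> \<Xi> ! i = 1 \<longleftrightarrow> spline_dim p \<Xi> \<le> i"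
    and "i < length \<Xi> \<Longrightarrow> 0 \<le> \<Xi> ! i \<and> \<Xi> ! i \<le> 1"
proof -
  let ?Z = "{i. i < length \<Xi> \<and> \<Xi> ! i = 0}" and ?O = "{i. i < length \<Xi> \<and> \<Xi> ! i = 1}"
  have sorted: "sorted \<Xi>" and card: "card ?Z = p + 1" "card ?O = p + 1"
    using assms by (auto simp: open_knot_vector_def count_list_eq_card)
  show range: "0 \<le> \<Xi> ! i \<and> \<Xi> ! i \<le> 1" if "i < length \<Xi>" for i
    using assms nth_mem[OF that] by (auto simp: open_knot_vector_def)
  have Z: "?Z = {..<p + 1}"
  proof -
    have "?Z = {..<card ?Z}"
    proof (rule downward_closed_eq_lessThan_card)
      fix i j assume i: "i \<in> ?Z" and j: "j < i"
      then have "\<Xi> ! j \<le> \<Xi> ! i" using sorted_nth_mono[OF sorted, of j i] by simp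
      then show "j \<in> ?Z" using i j range[of j] by auto
    qed simp
    then show ?thesis using card by simp
  qed
  let ?C = "{..<length \<Xi>} - ?O"
  have "?C = {..<card ?C}"
  proof (rule downward_closed_eq_lessThan_card)
    fix i j assume i: "i \<in> ?C" and j: "j < i"
    then have "\<Xi> ! j \<le> \<Xi> ! i" using sorted_nth_mono[OF sorted, of j i] by simp
    then show "j \<in> ?C" using i j range[of i] range[of j] by auto
  qed simp
  moreover have "card ?C = spline_dim p \<Xi>"
    using card by (subst card_Diff_subset) (auto simp: spline_dim_def)
  ultimately have C: "?C = {..<spline_dim p \<Xi>}" by simp
  have "card (?Z \<union> ?O) = 2 * p + 2"
    using card by (subst card_Un_disjoint) auto
  moreover have "card (?Z \<union> ?O) \<le> card {..<length \<Xi>}"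
    by (intro card_mono) auto
  ultimately show "2 * p + 2 \<le> length \<Xi>" by simp
  show "\<Xi> ! i = 0 \<longleftrightarrow> i \<le> p" if "i < length \<Xi>" for i
  proof -
    have "\<Xi> ! i = 0 \<longleftrightarrow> i \<in> ?Z" using that by auto
    then show ?thesis unfolding Z by auto
  qed
  show "\<Xi> ! i = 1 \<longleftrightarrow> spline_dim p \<Xi> \<le> i" if "i < length \<Xi>" for i
  proof -
    have "\<Xi> ! i \<noteq> 1 \<longleftrightarrow> i \<in> ?C" using that by auto
    then show ?thesis unfolding C by auto
  qed
qed

text \<open>Away from the knots no convention about closed or open spans interferes, and the recursion is a
  combination with positive weights of functions positive on the interiors of their supports.\<close>

lemma bspline_off_knots:
  assumes sorted: "sorted \<Xi>" and x: "x \<notin> set \<Xi>" and "i + p + 1 < length \<Xi>"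
  shows "(if \<Xi> ! i < x \<and> x < \<Xi> ! (i + p + 1) then bspline \<Xi> p i x > 0 else bspline \<Xi> p i x = 0)"
  using assms(3)
proof (induction p arbitrary: i)
  case 0
  then have "\<Xi> ! i \<in> set \<Xi>" "\<Xi> ! (i + 1) \<in> set \<Xi>" by (auto intro!: nth_mem)
  with x have "\<Xi> ! i \<noteq> x" "\<Xi> ! (i + 1) \<noteq> x" by metis+
  then show ?case by auto
next
  case (Suc p)
  have mem: "\<Xi> ! k \<noteq> x" if "k < length \<Xi>" for k
    using x nth_mem[OF that] by metis
  have le: "\<Xi> ! i \<le> \<Xi> ! (i + 1)" "\<Xi> ! (i + 1) \<le> \<Xi> ! (i + p + 1)"
      "\<Xi> ! (i + p + 1) \<le> \<Xi> ! (i + p + 2)"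
    using Suc.prems sorted by (auto intro!: sorted_nth_mono)
  have ne: "\<Xi> ! i \<noteq> x" "\<Xi> ! (i + 1) \<noteq> x" "\<Xi> ! (i + p + 1) \<noteq> x" "\<Xi> ! (i + p + 2) \<noteq> x"
    using Suc.prems by (auto intro!: mem)
  note IH1 = Suc.IH[of i] and IH2 = Suc.IH[of "i + 1"]
  let ?a = "(x - \<Xi> ! i) / (\<Xi> ! (i + p + 1) - \<Xi> ! i) * bspline \<Xi> p i x"
  let ?b = "(\<Xi> ! (i + p + 2) - x) / (\<Xi> ! (i + p + 2) - \<Xi> ! (i + 1)) * bspline \<Xi> p (i + 1) x"
  have a: "if \<Xi> ! i < x \<and> x < \<Xi> ! (i + p + 1) then ?a > 0 else ?a = 0"
    using IH1 Suc.prems by (auto split: if_splits)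
  have b: "if \<Xi> ! (i + 1) < x \<and> x < \<Xi> ! (i + p + 2) then ?b > 0 else ?b = 0"
    using IH2 Suc.prems by (auto split: if_splits)
  have "bspline \<Xi> (Suc p) i x = ?a + ?b" by simp
  moreover have "i + Suc p + 1 = i + p + 2" by simp
  ultimately show ?case
    using a b le ne by (smt (verit))
qed

text \<open>For general \<open>q\<close> the claim is about the functions met in the recursion. When the index sinks to
  \<open>i + q = p\<close> in the first summand, the function need not vanish at 0, but then its left knot is 0,
  so that its weight vanishes at 0.\<close>

lemma bspline_at_0:
  assumes \<Xi>: "open_knot_vector p \<Xi>" and "p < i + q" "i + q + 1 < length \<Xi>"
  shows "bspline \<Xi> q i 0 = 0"
  using assms(2,3)
proof (induction q arbitrary: i)
  case 0
  then have "\<Xi> ! i > 0"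
    using open_knot_vector_nth(2,4)[OF \<Xi>, of i] by auto
  then show ?case by auto
next
  case (Suc q)
  have "bspline \<Xi> q (i + 1) 0 = 0" using Suc by auto
  moreover have "\<Xi> ! i = 0 \<or> bspline \<Xi> q i 0 = 0"
  proof (cases "i \<le> p")
    case True
    then show ?thesis using open_knot_vector_nth(2)[OF \<Xi>, of i] Suc.prems by auto
  next
    case False
    then show ?thesis using Suc by auto
  qed
  ultimately show ?case by auto
qed

text \<open>The mirror image of the behaviour at 0: the second summand may involve the one function that does
  not vanish at 1, but then its right knot is 1, so that its weight vanishes at 1.\<close>

lemma bspline_at_1:
  assumes \<Xi>: "open_knot_vector p \<Xi>" and "i + 1 < spline_dim p \<Xi>" "q \<le> p"
  shows "bspline \<Xi> q i 1 = 0"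
  using assms(2,3)
proof (induction q arbitrary: i)
  case 0
  then have "i + 1 < length \<Xi>" by (auto simp: spline_dim_def)
  then have "\<Xi> ! i \<noteq> 1" "\<Xi> ! i \<le> 1" "\<Xi> ! (i + 1) \<noteq> 1" "\<Xi> ! (i + 1) \<le> 1"
    using open_knot_vector_nth(3,4)[OF \<Xi>, of i] open_knot_vector_nth(3,4)[OF \<Xi>, of "i + 1"] 0 by auto
  then show ?case by auto
next
  case (Suc q)
  have "bspline \<Xi> q i 1 = 0" using Suc by auto
  moreover have "\<Xi> ! (i + q + 2) = 1 \<or> bspline \<Xi> q (i + 1) 1 = 0"
  proof (cases "i + 1 + 1 < spline_dim p \<Xi>")
    case True
    then show ?thesis using Suc by auto
  next
    case False
    then have "spline_dim p \<Xi> \<le> i + q + 2" "i + q + 2 < length \<Xi>"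
      using Suc.prems by (auto simp: spline_dim_def)
    then show ?thesis using open_knot_vector_nth(3)[OF \<Xi>] by auto
  qed
  ultimately show ?case by auto
qed

lemma bspline_1_positive_somewhere:
  assumes \<Xi>: "open_knot_vector p \<Xi>" and p: "1 \<le> p"
  obtains x where "0 < x" "x < 1" "0 < bspline \<Xi> p 1 x"
proof -
  note nth = open_knot_vector_nth[OF \<Xi>]
  have sorted: "sorted \<Xi>" using \<Xi> by (simp add: open_knot_vector_def)
  let ?m = "\<Xi> ! (p + 1)"
  have m: "0 < ?m" "?m \<le> 1" using nth(1) nth(2,4)[of "p + 1"] by auto
  have "?m / 2 \<notin> set \<Xi>"
  proof
    assume "?m / 2 \<in> set \<Xi>"
    then obtain i where i: "i < length \<Xi>" "\<Xi> ! i = ?m / 2" by (auto simp: in_set_conv_nth)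
    then have "p + 1 \<le> i" using nth(2)[of i] m by auto
    then have "?m \<le> \<Xi> ! i" using sorted i by (auto intro: sorted_nth_mono)
    then show False using i m by simp
  qed
  moreover have "?m \<le> \<Xi> ! (1 + p + 1)"
    using nth(1) p by (intro sorted_nth_mono sorted) auto
  moreover have "\<Xi> ! 1 = 0" using nth(1) nth(2)[of 1] p by auto
  moreover have "1 + p + 1 < length \<Xi>" using nth(1) p by auto
  ultimately have "0 < bspline \<Xi> p 1 (?m / 2)"
    using bspline_off_knots[OF sorted, of "?m / 2" 1 p] m by (simp split: if_splits)
  with m show thesis by (intro that[of "?m / 2"]) auto
qed

lemma finite_tensor_index: "finite (tensor_index p \<Xi>)"
proof -
  have "tensor_index p \<Xi> = (\<Pi>\<^sub>E j\<in>UNIV. {..<spline_dim p (\<Xi> j)})"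
    by (auto simp: tensor_index_def PiE_def)
  then show ?thesis by (auto intro: finite_PiE)
qed

text \<open>The tensor product of the second B-splines in all directions. In time it vanishes at 0. In space
  it vanishes at both ends of each interval, because the degree is at least 2 and so the second
  B-spline is not the last one either.\<close>

lemma X_h0_nontrivial:
  fixes \<Xi>s :: "'d::finite \<Rightarrow> real list"
  assumes t: "open_knot_vector pt \<Xi>t" "1 \<le> pt"
    and s: "\<And>j. open_knot_vector ps (\<Xi>s j)" "2 \<le> ps"
  shows "\<exists>v\<in>X_h0 pt ps \<Xi>t \<Xi>s. \<exists>x\<in>{0<..<1} \<times> box 0 1. v x \<noteq> 0"
proof -
  let ?one = "\<lambda>j::'d. 1::nat"
  let ?v = "\<lambda>(\<tau>, \<eta>). complex_of_real (bspline \<Xi>t pt 1 \<tau> * tensor_bspline \<Xi>s ps ?one \<eta>)"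
  let ?c = "\<lambda>k i. if k = 1 then if i = ?one then 1 else 0 else (0::complex)"
  have dim_t: "1 < spline_dim pt \<Xi>t"
    using open_knot_vector_nth(1)[OF t(1)] t(2) by (auto simp: spline_dim_def)
  have dim_s: "2 < spline_dim ps (\<Xi>s j)" for j
    using open_knot_vector_nth(1)[OF s(1), of j] s(2) by (auto simp: spline_dim_def)
  have one: "?one \<in> tensor_index ps \<Xi>s"
  proof -
    have "1 < spline_dim ps (\<Xi>s j)" for j using dim_s[of j] by simp
    then show ?thesis by (simp add: tensor_index_def)
  qed
  have "?v = (\<lambda>(\<tau>, \<eta>). \<Sum>k<spline_dim pt \<Xi>t. \<Sum>i\<in>tensor_index ps \<Xi>s.
      ?c k i * of_real (bspline \<Xi>t pt k \<tau> * tensor_bspline \<Xi>s ps i \<eta>))"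
  proof (intro ext, clarify)
    fix \<tau> :: real and \<eta> :: "real^'d"
    have "(\<Sum>k<spline_dim pt \<Xi>t. \<Sum>i\<in>tensor_index ps \<Xi>s.
        ?c k i * of_real (bspline \<Xi>t pt k \<tau> * tensor_bspline \<Xi>s ps i \<eta>))
      = (\<Sum>k<spline_dim pt \<Xi>t. if k = 1 then (\<Sum>i\<in>tensor_index ps \<Xi>s. if i = ?one then
           of_real (bspline \<Xi>t pt k \<tau> * tensor_bspline \<Xi>s ps i \<eta>) else 0) else 0)"
      by (intro sum.cong refl) (auto intro!: sum.cong)
    also have "\<dots> = of_real (bspline \<Xi>t pt 1 \<tau> * tensor_bspline \<Xi>s ps ?one \<eta>)"
      using dim_t one by (simp add: sum.delta finite_tensor_index)
    finally show "of_real (bspline \<Xi>t pt 1 \<tau> * tensor_bspline \<Xi>s ps ?one \<eta>)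
      = (\<Sum>k<spline_dim pt \<Xi>t. \<Sum>i\<in>tensor_index ps \<Xi>s.
        ?c k i * of_real (bspline \<Xi>t pt k \<tau> * tensor_bspline \<Xi>s ps i \<eta>))" by simp
  qed
  moreover have "?v p = 0" if "p \<in> {0} \<times> box 0 1 \<union> {0<..<1} \<times> frontier (box 0 1)" for p
  proof -
    obtain \<tau> \<eta> where p: "p = (\<tau>, \<eta>)" by force
    from that p consider "\<tau> = 0" | "\<eta> \<in> frontier (box 0 1)" by auto
    then show ?thesis
    proof cases
      case 1
      have "bspline \<Xi>t pt 1 0 = 0"
        using open_knot_vector_nth(1)[OF t(1)] t by (intro bspline_at_0) auto
      then show ?thesis using 1 p by simp
    next
      case 2
      have "box (0::real^'d) 1 \<noteq> {}" by (simp add: interval_ne_empty_cart)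
      then have "frontier (box (0::real^'d) 1) = cbox 0 1 - box 0 1"
        by (simp add: frontier_def closure_box interior_open[OF open_box])
      with 2 have "\<eta> \<in> cbox 0 1" "\<eta> \<notin> box 0 1" by auto
      then obtain j where "0 \<le> \<eta> $ j" "\<eta> $ j \<le> 1" "\<not> (0 < \<eta> $ j \<and> \<eta> $ j < 1)"
        unfolding mem_box_cart zero_index one_index by blast
      then have "\<eta> $ j = 0 \<or> \<eta> $ j = 1" by linarith
      moreover have "bspline (\<Xi>s j) ps 1 0 = 0"
        using open_knot_vector_nth(1)[OF s(1), of j] s by (intro bspline_at_0) auto
      moreover have "bspline (\<Xi>s j) ps 1 1 = 0"
        using dim_s[of j] s by (intro bspline_at_1[OF s(1)]) auto
      ultimately have "bspline (\<Xi>s j) ps 1 (\<eta> $ j) = 0" by auto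
      then have "tensor_bspline \<Xi>s ps ?one \<eta> = 0"
        unfolding tensor_bspline_def by (subst prod_zero_iff) auto
      then show ?thesis using p by simp
    qed
  qed
  ultimately have "?v \<in> X_h0 pt ps \<Xi>t \<Xi>s"
    unfolding X_h0_def by (auto intro!: exI[of _ ?c])
  moreover have "\<exists>x\<in>{0<..<1} \<times> box 0 1. ?v x \<noteq> 0"
  proof -
    obtain \<tau> where \<tau>: "0 < \<tau>" "\<tau> < 1" "0 < bspline \<Xi>t pt 1 \<tau>"
      using bspline_1_positive_somewhere[OF t] by blast
    have "\<exists>x. 0 < x \<and> x < 1 \<and> 0 < bspline (\<Xi>s j) ps 1 x" for j
      using bspline_1_positive_somewhere[OF s(1)[of j]] s(2) by force
    then obtain y where y: "\<And>j. 0 < y j" "\<And>j. y j < 1" "\<And>j. 0 < bspline (\<Xi>s j) ps 1 (y j)"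
      by metis
    have "(\<tau>, (\<chi> j. y j)) \<in> {0<..<1} \<times> box 0 1"
      using \<tau> y by (auto simp: mem_box_cart)
    moreover have "?v (\<tau>, (\<chi> j. y j)) \<noteq> 0"
    proof -
      have "bspline (\<Xi>s j) ps 1 (y j) \<noteq> 0" for j using y(3)[of j] by simp
      then show ?thesis
        using \<tau>(3) by (auto simp: tensor_bspline_def prod_zero_iff simp del: of_real_mult)
    qed
    ultimately show ?thesis by blast
  qed
  ultimately show ?thesis by blast
qed

section \<open>Definite forms on finite dimensional spaces of functions\<close>

definition fscale :: "complex \<Rightarrow> ('a \<Rightarrow> complex) \<Rightarrow> 'a \<Rightarrow> complex" where
  "fscale c v = (\<lambda>p. c * v p)"

interpretation fun_space: vector_space fscale
  by unfold_locales (auto simp: fscale_def fun_eq_iff algebra_simps)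

lemma sum_fun_apply: "(\<Sum>i\<in>I. f i) x = (\<Sum>i\<in>I. f i x)"
  by (induction I rule: infinite_finite_induct) auto

definition antilinear_on :: "('a \<Rightarrow> complex) set \<Rightarrow> (('a \<Rightarrow> complex) \<Rightarrow> complex) \<Rightarrow> bool" where
  "antilinear_on X l \<longleftrightarrow> (\<forall>u\<in>X. \<forall>v\<in>X. l (u + v) = l u + l v)
      \<and> (\<forall>c. \<forall>v\<in>X. l (fscale c v) = cnj c * l v)"

lemma antilinear_on_0:
  assumes "antilinear_on X l" "0 \<in> X"
  shows "l 0 = 0"
proof -
  have "l (fscale 0 0) = cnj 0 * l 0"
    using assms unfolding antilinear_on_def by blast
  then show ?thesis by simp
qed

lemma antilinear_eq_on_span:
  assumes X: "fun_space.subspace X" and B: "B \<subseteq> X"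
    and l: "antilinear_on X l" "antilinear_on X m"
    and eq: "\<And>v. v \<in> B \<Longrightarrow> l v = m v" and v: "v \<in> fun_space.span B"
  shows "l v = m v"
proof -
  have "l 0 = 0" "m 0 = 0"
    using l antilinear_on_0 fun_space.subspace_0[OF X] by auto
  then have "fun_space.subspace {v \<in> X. l v = m v}"
    using X l unfolding fun_space.subspace_def antilinear_on_def by auto
  then have "fun_space.span B \<subseteq> {v \<in> X. l v = m v}"
    using eq B by (intro fun_space.span_minimal) auto
  then show ?thesis using v by auto
qed

text \<open>Representation of antilinear functionals by a definite sesquilinear form, by induction over a
  finite spanning set. As in the Gram--Schmidt process, the new vector is first made orthogonal to the
  span of the old ones, and the solution on that span is then corrected along it.\<close>

lemma finite_dim_riesz:
  fixes s :: "('a \<Rightarrow> complex) \<Rightarrow> ('a \<Rightarrow> complex) \<Rightarrow> complex"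
  assumes X: "fun_space.subspace X"
    and add: "\<And>u u' v. u \<in> X \<Longrightarrow> u' \<in> X \<Longrightarrow> v \<in> X \<Longrightarrow> s (u + u') v = s u v + s u' v"
    and scale: "\<And>c u v. u \<in> X \<Longrightarrow> v \<in> X \<Longrightarrow> s (fscale c u) v = c * s u v"
    and anti: "\<And>u. u \<in> X \<Longrightarrow> antilinear_on X (s u)"
    and definite: "\<And>v. v \<in> X \<Longrightarrow> s v v = 0 \<Longrightarrow> v = 0"
    and "finite B" "B \<subseteq> X" "antilinear_on X l"
  shows "\<exists>u\<in>fun_space.span B. \<forall>v\<in>fun_space.span B. s u v = l v"
  using assms(6-8)
proof (induction B arbitrary: l rule: finite_induct)
  case empty
  have "0 \<in> X" by (rule fun_space.subspace_0[OF X])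
  then have "s 0 0 = 0" "l 0 = 0"
    using anti[of 0] empty antilinear_on_0 by blast+
  then have "s 0 0 = l 0" by simp
  then show ?case unfolding fun_space.span_empty by blast
next
  case (insert b B)
  let ?span = "fun_space.span"
  have BX: "B \<subseteq> X" and b: "b \<in> X" and l: "antilinear_on X l" using insert.prems by auto
  have sub: "?span (insert b B) \<subseteq> X"
    using insert.prems X by (intro fun_space.span_minimal) auto
  have mono: "?span B \<subseteq> ?span (insert b B)" by (intro fun_space.span_mono) auto
  obtain u where u: "u \<in> ?span B" "\<And>v. v \<in> ?span B \<Longrightarrow> s u v = l v"
    using insert.IH[OF BX l] by blast
  obtain d where d: "d \<in> ?span B" "\<And>v. v \<in> ?span B \<Longrightarrow> s d v = s b v"
    using insert.IH[OF BX anti[OF b]] by blast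
  \<comment> \<open>the part of b orthogonal to the span of B; d represents the functional s b there\<close>
  define r where "r = b + fscale (- 1) d"
  have uX: "u \<in> X" and dX: "d \<in> X" using u d sub mono by auto
  have r: "r \<in> ?span (insert b B)"
    unfolding r_def
    by (intro fun_space.span_add fun_space.span_scale fun_space.span_base insertI1 subsetD[OF mono d(1)])
  then have rX: "r \<in> X" using sub by auto
  have r_orth: "s r v = 0" if "v \<in> ?span B" for v
  proof -
    have "v \<in> X" using that mono sub by auto
    have "s r v = s b v + s (fscale (- 1) d) v"
      unfolding r_def by (rule add[OF b fun_space.subspace_scale[OF X dX] \<open>v \<in> X\<close>])
    also have "s (fscale (- 1) d) v = - 1 * s d v"
      by (rule scale[OF dX \<open>v \<in> X\<close>])
    finally show ?thesis using d(2)[OF that] by simp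
  qed
  define t where "t = (l r - s u r) / s r r"
  have w: "u + fscale t r \<in> ?span (insert b B)"
    using u(1) mono r by (intro fun_space.span_add fun_space.span_scale) auto
  have s_w: "s (u + fscale t r) v = s u v + t * s r v" if "v \<in> X" for v
    using uX rX X that by (simp add: add scale fun_space.subspace_scale)
  have at_r: "s (u + fscale t r) r = l r"
  proof (cases "s r r = 0")
    case True
    then have "r = 0" using definite rX by blast
    then have "s u r = 0" "l r = 0"
      using antilinear_on_0[OF anti[OF uX]] antilinear_on_0[OF l] fun_space.subspace_0[OF X] by auto
    then show ?thesis using True unfolding s_w[OF rX] by simp
  next
    case False
    then show ?thesis unfolding s_w[OF rX] by (simp add: t_def)
  qed
  have at_B: "s (u + fscale t r) v = l v" if "v \<in> ?span B" for v
    using that mono sub u(2) r_orth by (subst s_w) auto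
  have wX: "u + fscale t r \<in> X" using w sub by auto
  have "s (u + fscale t r) v = l v" if "v \<in> ?span (insert b B)" for v
  proof (rule antilinear_eq_on_span[OF X _ anti[OF wX] l _ that])
    fix v assume "v \<in> insert b B"
    moreover have "s (u + fscale t r) b = l b"
    proof -
      have "b = r + d" by (simp add: r_def fscale_def fun_eq_iff)
      then show ?thesis
        using anti[OF wX] l rX dX at_r at_B[OF d(1)] unfolding antilinear_on_def by metis
    qed
    ultimately show "s (u + fscale t r) v = l v"
      using at_B by (auto intro: fun_space.span_base)
  qed (use insert.prems in auto)
  then show ?case using w by blast
qed

text \<open>The boundary conditions cut out a subspace of the span of the tensor product B-splines, for which
  no explicit basis is available; a finite one exists by dimension.\<close>

lemma subspace_of_span_finite_basis:
  assumes "fun_space.subspace X" "X \<subseteq> fun_space.span E" "finite E"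
  obtains B where "finite B" "B \<subseteq> X" "fun_space.span B = X"
proof -
  obtain B where B: "B \<subseteq> X" "fun_space.independent B" "X \<subseteq> fun_space.span B"
    by (rule fun_space.maximal_independent_subset)
  then have "finite B"
    using fun_space.independent_span_bound[OF assms(3) B(2)] assms(2) by auto
  moreover have "fun_space.span B = X"
    using B assms(1) by (intro equalityI fun_space.span_minimal)
  ultimately show thesis using B that by blast
qed

section \<open>The discrete space\<close>

text \<open>By invariance of domain the image of the open set where \<open>v\<close> differs from \<open>c\<close> is open, so it has
  positive measure unless it is empty.\<close>

lemma continuous_pullback_AE_eq_0:
  fixes G :: "'a::euclidean_space \<Rightarrow> 'a" and v :: "'a \<Rightarrow> 'b::t1_space"
  assumes D: "open D" and G: "continuous_on D G" "inj_on G D" and v: "continuous_on D v"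
    and AE: "AE p in lebesgue_on (G ` D). v (inv_into D G p) = c"
    and x: "x \<in> D"
  shows "v x = c"
proof (rule ccontr)
  assume "v x \<noteq> c"
  define U where "U = D \<inter> v -` (- {c})"
  have "open U"
    unfolding U_def using v D by (intro continuous_open_preimage) auto
  then have GU: "open (G ` U)"
    using G by (intro invariance_of_domain) (auto simp: U_def intro: continuous_on_subset inj_on_subset)
  have GD: "open (G ` D)" by (intro invariance_of_domain G D)
  have "AE p in lebesgue. p \<in> G ` D \<longrightarrow> v (inv_into D G p) = c"
    using AE GD by (subst (asm) AE_restrict_space_iff) auto
  moreover have "v (inv_into D G p) \<noteq> c \<and> p \<in> G ` D" if "p \<in> G ` U" for p
    using that G(2) by (auto simp: U_def inv_into_f_f)
  ultimately have "AE p in lebesgue. p \<notin> G ` U"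
    by (auto elim!: eventually_mono)
  then have "negligible (G ` U)"
    using GU by (simp add: negligible_iff_null_sets AE_iff_null_sets)
  moreover have "G ` U \<noteq> {}"
    using x \<open>v x \<noteq> c\<close> by (auto simp: U_def)
  ultimately show False
    using GU open_not_negligible by blast
qed

lemma subspace_V_h: "fun_space.subspace (V_h T \<Omega> F pt ps \<Xi>t \<Xi>s)"
proof -
  let ?X = "X_h0 pt ps \<Xi>t \<Xi>s"
  let ?E = "\<lambda>v p. if p \<in> cylinder T \<Omega> then v (inv_into ({0<..<1} \<times> box 0 1) (G_map T F) p) else (0::complex)"
  have X0: "(\<lambda>p. 0) \<in> ?X"
    unfolding X_h0_def by (auto intro!: exI[of _ "\<lambda>k i. 0"])
  have Xadd: "(\<lambda>p. u p + v p) \<in> ?X" if u: "u \<in> ?X" and v: "v \<in> ?X" for u v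
  proof -
    from u obtain c where c: "u = (\<lambda>(\<tau>, \<eta>). \<Sum>k<spline_dim pt \<Xi>t. \<Sum>i\<in>tensor_index ps \<Xi>s.
        c k i * of_real (bspline \<Xi>t pt k \<tau> * tensor_bspline \<Xi>s ps i \<eta>))"
      unfolding X_h0_def by blast
    from v obtain d where d: "v = (\<lambda>(\<tau>, \<eta>). \<Sum>k<spline_dim pt \<Xi>t. \<Sum>i\<in>tensor_index ps \<Xi>s.
        d k i * of_real (bspline \<Xi>t pt k \<tau> * tensor_bspline \<Xi>s ps i \<eta>))"
      unfolding X_h0_def by blast
    have "(\<lambda>p. u p + v p) = (\<lambda>(\<tau>, \<eta>). \<Sum>k<spline_dim pt \<Xi>t. \<Sum>i\<in>tensor_index ps \<Xi>s.
        (c k i + d k i) * of_real (bspline \<Xi>t pt k \<tau> * tensor_bspline \<Xi>s ps i \<eta>))"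
      unfolding c d by (simp add: fun_eq_iff sum.distrib distrib_right)
    moreover have "\<forall>p \<in> {0} \<times> box 0 1 \<union> {0<..<1} \<times> frontier (box 0 1). u p + v p = 0"
      using u v unfolding X_h0_def by (metis (mono_tags, lifting) add.right_neutral mem_Collect_eq)
    ultimately show ?thesis
      unfolding X_h0_def mem_Collect_eq by (intro conjI exI[of _ "\<lambda>k i. c k i + d k i"])
  qed
  have Xscale: "(\<lambda>p. a * v p) \<in> ?X" if v: "v \<in> ?X" for a v
  proof -
    from v obtain d where d: "v = (\<lambda>(\<tau>, \<eta>). \<Sum>k<spline_dim pt \<Xi>t. \<Sum>i\<in>tensor_index ps \<Xi>s.
        d k i * of_real (bspline \<Xi>t pt k \<tau> * tensor_bspline \<Xi>s ps i \<eta>))"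
      unfolding X_h0_def by blast
    have "(\<lambda>p. a * v p) = (\<lambda>(\<tau>, \<eta>). \<Sum>k<spline_dim pt \<Xi>t. \<Sum>i\<in>tensor_index ps \<Xi>s.
        (a * d k i) * of_real (bspline \<Xi>t pt k \<tau> * tensor_bspline \<Xi>s ps i \<eta>))"
      unfolding d by (simp add: fun_eq_iff sum_distrib_left mult.assoc)
    moreover have "\<forall>p \<in> {0} \<times> box 0 1 \<union> {0<..<1} \<times> frontier (box 0 1). a * v p = 0"
      using v unfolding X_h0_def by (metis (mono_tags, lifting) mult_zero_right mem_Collect_eq)
    ultimately show ?thesis
      unfolding X_h0_def mem_Collect_eq by (intro conjI exI[of _ "\<lambda>k i. a * d k i"])
  qed
  have E: "V_h T \<Omega> F pt ps \<Xi>t \<Xi>s = ?E ` ?X"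
    by (simp add: V_h_def)
  show ?thesis
  proof (rule fun_space.subspaceI)
    have "0 = ?E (\<lambda>p. 0)" by (simp add: fun_eq_iff)
    then show "0 \<in> V_h T \<Omega> F pt ps \<Xi>t \<Xi>s" unfolding E using X0 by (rule image_eqI)
  next
    fix u v assume "u \<in> V_h T \<Omega> F pt ps \<Xi>t \<Xi>s" "v \<in> V_h T \<Omega> F pt ps \<Xi>t \<Xi>s"
    then obtain u' v' where *: "u' \<in> ?X" "v' \<in> ?X" "u = ?E u'" "v = ?E v'" unfolding E by blast
    have "u + v = ?E (\<lambda>p. u' p + v' p)" unfolding * by (simp add: fun_eq_iff)
    then show "u + v \<in> V_h T \<Omega> F pt ps \<Xi>t \<Xi>s" unfolding E using Xadd[OF *(1,2)] by (rule image_eqI)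
  next
    fix a v assume "v \<in> V_h T \<Omega> F pt ps \<Xi>t \<Xi>s"
    then obtain v' where *: "v' \<in> ?X" "v = ?E v'" unfolding E by blast
    have "fscale a v = ?E (\<lambda>p. a * v' p)" unfolding * by (simp add: fun_eq_iff fscale_def)
    then show "fscale a v \<in> V_h T \<Omega> F pt ps \<Xi>t \<Xi>s" unfolding E using Xscale[OF *(1)] by (rule image_eqI)
  qed
qed

lemma V_h_finite_basis:
  obtains B where "finite B" "B \<subseteq> V_h T \<Omega> F pt ps \<Xi>t \<Xi>s" "fun_space.span B = V_h T \<Omega> F pt ps \<Xi>t \<Xi>s"
proof -
  let ?g = "inv_into ({0<..<1} \<times> box 0 1) (G_map T F)"
  let ?I = "tensor_index ps \<Xi>s" and ?N = "spline_dim pt \<Xi>t"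
  define e where "e k i = (\<lambda>p. if p \<in> cylinder T \<Omega> then
      complex_of_real (bspline \<Xi>t pt k (fst (?g p)) * tensor_bspline \<Xi>s ps i (snd (?g p))) else 0)" for k i
  let ?E = "(\<lambda>(k, i). e k i) ` ({..<?N} \<times> ?I)"
  have "V_h T \<Omega> F pt ps \<Xi>t \<Xi>s \<subseteq> fun_space.span ?E"
  proof
    fix u assume "u \<in> V_h T \<Omega> F pt ps \<Xi>t \<Xi>s"
    then obtain c where u: "u = (\<lambda>p. if p \<in> cylinder T \<Omega> then (\<lambda>(\<tau>, \<eta>). \<Sum>k<?N. \<Sum>i\<in>?I.
        c k i * of_real (bspline \<Xi>t pt k \<tau> * tensor_bspline \<Xi>s ps i \<eta>)) (?g p) else 0)"
      unfolding V_h_def X_h0_def by blast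
    have "u = (\<Sum>k<?N. \<Sum>i\<in>?I. fscale (c k i) (e k i))"
      by (rule ext) (simp add: u sum_fun_apply fscale_def e_def case_prod_unfold)
    also have "\<dots> \<in> fun_space.span ?E"
      by (intro fun_space.span_sum fun_space.span_scale fun_space.span_base) auto
    finally show "u \<in> fun_space.span ?E" .
  qed
  moreover have "finite ?E" by (simp add: finite_tensor_index)
  ultimately show thesis
    using subspace_of_span_finite_basis[OF subspace_V_h] that by metis
qed

lemma X_h0_continuous:
  assumes t: "\<And>s. s \<in> spline_space pt \<Xi>t \<Longrightarrow> continuous_on {0<..<1} s"
    and s: "\<And>s. s \<in> tensor_spline_space ps \<Xi>s \<Longrightarrow> continuous_on (box 0 1) s"
    and v: "v \<in> X_h0 pt ps \<Xi>t \<Xi>s"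
  shows "continuous_on ({0<..<1} \<times> box 0 1) v"
proof -
  let ?I = "tensor_index ps \<Xi>s" and ?N = "spline_dim pt \<Xi>t"
  have t': "continuous_on {0<..<1} (bspline \<Xi>t pt k)" if "k < ?N" for k
  proof (rule t)
    have "bspline \<Xi>t pt k = (\<lambda>x. \<Sum>i<?N. (if i = k then 1 else 0) * bspline \<Xi>t pt i x)"
      using that by (intro ext) (simp add: if_distrib[where f = "\<lambda>a. a * _"] sum.delta cong: if_cong)
    then show "bspline \<Xi>t pt k \<in> spline_space pt \<Xi>t"
      unfolding spline_space_def mem_Collect_eq by (rule exI[of _ "\<lambda>i. if i = k then 1 else 0"])
  qed
  have s': "continuous_on (box 0 1) (tensor_bspline \<Xi>s ps k)" if "k \<in> ?I" for k
  proof (rule s)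
    have "tensor_bspline \<Xi>s ps k = (\<lambda>x. \<Sum>i\<in>?I. (if i = k then 1 else 0) * tensor_bspline \<Xi>s ps i x)"
      using that
      by (intro ext) (simp add: if_distrib[where f = "\<lambda>a. a * _"] sum.delta finite_tensor_index cong: if_cong)
    then show "tensor_bspline \<Xi>s ps k \<in> tensor_spline_space ps \<Xi>s"
      unfolding tensor_spline_space_def mem_Collect_eq by (rule exI[of _ "\<lambda>i. if i = k then 1 else 0"])
  qed
  obtain c where c: "v = (\<lambda>(\<tau>, \<eta>). \<Sum>k<?N. \<Sum>i\<in>?I.
        c k i * of_real (bspline \<Xi>t pt k \<tau> * tensor_bspline \<Xi>s ps i \<eta>))"
    using v unfolding X_h0_def by blast
  have "continuous_on ({0<..<1} \<times> box 0 1) (\<lambda>x. \<Sum>k<?N. \<Sum>i\<in>?I.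
        c k i * of_real (bspline \<Xi>t pt k (fst x) * tensor_bspline \<Xi>s ps i (snd x)))"
    by (intro continuous_on_sum continuous_on_mult continuous_on_const continuous_on_of_real
        continuous_on_compose2[OF t' continuous_on_fst] continuous_on_compose2[OF s' continuous_on_snd]
        continuous_on_id) auto
  then show ?thesis unfolding c by (simp add: case_prod_unfold)
qed

lemma spline_parametrization_continuous:
  fixes F :: "real^'d \<Rightarrow> real^'d"
  assumes s: "\<And>s. s \<in> tensor_spline_space p \<Xi> \<Longrightarrow> continuous_on (box 0 1) s"
    and F: "spline_parametrization p \<Xi> \<Omega> F"
  shows "continuous_on (box 0 1) F"
proof -
  have "continuous_on (box 0 1) (\<lambda>\<eta>. F \<eta> $ j)" for j
  proof -
    obtain s where "s \<in> tensor_spline_space p \<Xi>" "\<And>\<eta>. \<eta> \<in> cbox 0 1 \<Longrightarrow> F \<eta> $ j = s \<eta>"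
      using F unfolding spline_parametrization_def by blast
    then show ?thesis
      using assms(1)[of s] box_subset_cbox by (subst continuous_on_cong[OF refl, of _ _ s]) auto
  qed
  then have "continuous_on (box 0 1) (\<lambda>\<eta>. \<chi> j. F \<eta> $ j)"
    by (rule continuous_on_vec_lambda)
  then show ?thesis by (simp add: vec_nth_inverse)
qed

lemma G_map_bij:
  assumes "T > 0" "bij_betw F (box 0 1) \<Omega>"
  shows "inj_on (G_map T F) ({0<..<1} \<times> box 0 1)"
    and "G_map T F ` ({0<..<1} \<times> box 0 1) = cylinder T \<Omega>"
proof -
  have inj: "inj_on F (box 0 1)" and im: "F ` box 0 1 = \<Omega>"
    using assms(2) by (auto simp: bij_betw_def)
  show "inj_on (G_map T F) ({0<..<1} \<times> box 0 1)"
    using inj assms(1) by (auto simp: inj_on_def G_map_def)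
  have "G_map T F ` ({0<..<1} \<times> box 0 1) = ((*) T ` {0<..<1}) \<times> F ` box 0 1"
    by (force simp: G_map_def)
  also have "(*) T ` {0<..<1} = {0<..<T}"
  proof
    show "{0<..<T} \<subseteq> (*) T ` {0<..<1}"
    proof
      fix t assume "t \<in> {0<..<T}"
      then have "t = T * (t / T)" "t / T \<in> {0<..<1}" using assms(1) by auto
      then show "t \<in> (*) T ` {0<..<1}" by (rule image_eqI)
    qed
  qed (use assms(1) in auto)
  finally show "G_map T F ` ({0<..<1} \<times> box 0 1) = cylinder T \<Omega>"
    by (simp add: im cylinder_def)
qed

text \<open>Discrete functions are continuous on the cylinder up to the homeomorphism \<open>G\<close>, so that equality
  almost everywhere is equality. Uniqueness of the discrete solution as a function rests on this.\<close>

lemma V_h_eq_0_if_AE: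
  assumes T: "T > 0"
    and t: "\<And>s. s \<in> spline_space pt \<Xi>t \<Longrightarrow> continuous_on {0<..<1} s"
    and s: "\<And>s. s \<in> tensor_spline_space ps \<Xi>s \<Longrightarrow> continuous_on (box 0 1) s"
    and F: "spline_parametrization ps \<Xi>s \<Omega> F"
    and u: "u \<in> V_h T \<Omega> F pt ps \<Xi>t \<Xi>s" and AE: "AE p in lebesgue_on (cylinder T \<Omega>). u p = 0"
  shows "u = 0"
proof -
  let ?D = "{0<..<1} \<times> box 0 1" and ?G = "G_map T F"
  have bij: "bij_betw F (box 0 1) \<Omega>" using F by (simp add: spline_parametrization_def)
  note G = G_map_bij[OF T bij]
  obtain v where v: "v \<in> X_h0 pt ps \<Xi>t \<Xi>s"
    and uv: "u = (\<lambda>p. if p \<in> cylinder T \<Omega> then v (inv_into ?D ?G p) else 0)"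
    using u unfolding V_h_def by blast
  have contF: "continuous_on (box 0 1) F" by (rule spline_parametrization_continuous[OF s F])
  have "continuous_on ?D (\<lambda>x. (T * fst x, F (snd x)))"
    by (intro continuous_intros continuous_on_compose2[OF contF]) auto
  then have contG: "continuous_on ?D ?G" by (simp add: G_map_def case_prod_unfold)
  have "open (?G ` ?D)"
    by (intro invariance_of_domain contG G open_Times) auto
  have AE': "AE p in lebesgue_on (?G ` ?D). v (inv_into ?D ?G p) = 0"
  proof -
    have "AE p in lebesgue_on (cylinder T \<Omega>). p \<in> cylinder T \<Omega>"
      by (rule AE_I2) simp
    with AE have "AE p in lebesgue_on (cylinder T \<Omega>). v (inv_into ?D ?G p) = 0"
      by eventually_elim (simp add: uv)
    then show ?thesis unfolding G(2) .
  qed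
  have "v x = 0" if "x \<in> ?D" for x
    by (rule continuous_pullback_AE_eq_0[OF _ contG G(1) X_h0_continuous[OF t s v] AE' that])
      (auto intro: open_Times)
  moreover have "inv_into ?D ?G p \<in> ?D" if "p \<in> cylinder T \<Omega>" for p
    using that by (intro inv_into_into) (simp add: G)
  ultimately show ?thesis unfolding uv by (auto simp: fun_eq_iff)
qed

lemma V_h_nontrivial:
  assumes T: "T > 0" and F: "bij_betw F (box 0 1) \<Omega>"
    and t: "open_knot_vector pt \<Xi>t" "1 \<le> pt"
    and s: "\<And>j. open_knot_vector ps (\<Xi>s j)" "2 \<le> ps"
  shows "\<exists>u\<in>V_h T \<Omega> F pt ps \<Xi>t \<Xi>s. u \<noteq> 0"
proof -
  let ?D = "{0<..<1} \<times> box 0 1" and ?G = "G_map T F"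
  note G = G_map_bij[OF T F]
  obtain v x where v: "v \<in> X_h0 pt ps \<Xi>t \<Xi>s" and x: "x \<in> ?D" "v x \<noteq> 0"
    using X_h0_nontrivial[OF t, of ps \<Xi>s, OF s] by blast
  let ?u = "\<lambda>p. if p \<in> cylinder T \<Omega> then v (inv_into ?D ?G p) else 0"
  have "?G x \<in> cylinder T \<Omega>" using x(1) G(2) by blast
  then have "?u (?G x) \<noteq> 0" using x G(1) by (simp add: inv_into_f_f)
  then have "?u \<noteq> 0" unfolding fun_eq_iff zero_fun_apply by blast
  moreover have "?u \<in> V_h T \<Omega> F pt ps \<Xi>t \<Xi>s" unfolding V_h_def by (rule image_eqI[OF refl v])
  ultimately show ?thesis by blast
qed

section \<open>Stability and quasi-optimality\<close>

text \<open>The scalar core of the error estimate. Here \<open>a\<close> and \<open>r\<close> stand for the norms of the error and of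
  its image under the operator, \<open>z\<close> and \<open>s\<close> for those of a discrete function. It plays the role of
  Kato's identity \<open>\<parallel>I - P\<parallel> = \<parallel>P\<parallel>\<close> for oblique projections \<open>P\<close>, and gives the constant \<open>1 / \<alpha>\<close>
  where the triangle inequality would give \<open>1 + 1 / \<alpha>\<close>. The difference of the two sides of
  \<open>\<alpha>\<^sup>2 * a\<^sup>2 \<le> (a - z)\<^sup>2 + s\<^sup>2\<close>, multiplied by \<open>1 - \<alpha>\<^sup>2\<close>, is bounded below by a perfect square.\<close>

lemma stable_projection_inequality:
  fixes a z s r \<alpha> :: real
  assumes \<alpha>: "0 < \<alpha>" "\<alpha> \<le> 1" and stable: "\<alpha>\<^sup>2 * (z\<^sup>2 + s\<^sup>2) \<le> s\<^sup>2"
  shows "\<alpha>\<^sup>2 * (a\<^sup>2 + r\<^sup>2) \<le> (a - z)\<^sup>2 + r\<^sup>2 + s\<^sup>2"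
proof -
  let ?b = "\<alpha>\<^sup>2"
  have b: "0 < ?b" "?b \<le> 1" using \<alpha> by (auto simp: power_le_one)
  have r: "?b * r\<^sup>2 \<le> r\<^sup>2" using b by (intro mult_left_le_one_le) auto
  have "?b * a\<^sup>2 \<le> (a - z)\<^sup>2 + s\<^sup>2"
  proof (cases "?b = 1")
    case True
    then show ?thesis using stable by simp
  next
    case False
    then have c: "0 < 1 - ?b" using b by simp
    have "?b * z\<^sup>2 \<le> (1 - ?b) * s\<^sup>2" using stable by (simp add: algebra_simps)
    moreover have "(1 - ?b) * (a - z)\<^sup>2 + ?b * z\<^sup>2 - (1 - ?b) * (?b * a\<^sup>2) = ((1 - ?b) * a - z)\<^sup>2"
      by (simp add: power2_eq_square algebra_simps)
    moreover have "0 \<le> ((1 - ?b) * a - z)\<^sup>2" by simp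
    ultimately have "(1 - ?b) * (?b * a\<^sup>2) \<le> (1 - ?b) * (a - z)\<^sup>2 + (1 - ?b) * s\<^sup>2"
      by linarith
    then have "(1 - ?b) * (?b * a\<^sup>2) \<le> (1 - ?b) * ((a - z)\<^sup>2 + s\<^sup>2)"
      by (simp only: distrib_left)
    then show ?thesis using c by (simp only: mult_le_cancel_left_pos)
  qed
  then show ?thesis using r by (simp add: distrib_left)
qed

context schroedinger_cylinder
begin

definition graph_norm :: "(real \<times> (real^'d) \<Rightarrow> complex) \<Rightarrow> real" where
  "graph_norm v = sqrt ((L2_norm Q v)\<^sup>2 + (L2_norm Q (S v))\<^sup>2)"

lemma V_norm_eq: "v \<in> V \<Longrightarrow> V_norm \<nu> T \<Omega> v = ennreal (graph_norm v)"
  by (simp add: V_norm_def graph_norm_def)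

lemma graph_norm_nonneg: "0 \<le> graph_norm v"
  by (simp add: graph_norm_def)

lemma graph_norm_square: "(graph_norm v)\<^sup>2 = (L2_norm Q v)\<^sup>2 + (L2_norm Q (S v))\<^sup>2"
  by (simp add: graph_norm_def)

lemma graph_norm_pos:
  assumes "v \<in> L2 Q" "L2_nonzero Q v"
  shows "0 < graph_norm v"
proof -
  have "L2_norm Q v \<noteq> 0" using assms(2) L2_norm_eq_0_iff[OF assms(1)] by (simp add: L2_nonzero_def)
  then show ?thesis unfolding graph_norm_def by (simp add: add_pos_nonneg)
qed

text \<open>Outside \<open>V\<close> the norm in the denominator is infinite and all quotients vanish, so a positive
  inf-sup constant forces the discrete functions into \<open>V\<close>. Inside \<open>V\<close>, Cauchy--Schwarz bounds the
  supremum by the quotient of \<open>L2_norm Q (S v)\<close> and the graph norm.\<close>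

lemma inf_sup_const_imp_stable:
  assumes \<alpha>: "0 < \<alpha>" "ennreal \<alpha> \<le> inf_sup_const \<nu> T \<Omega> Vh Wh"
    and Wh: "Wh \<subseteq> L2 Q" and v: "v \<in> Vh" "L2_nonzero Q v"
  shows "v \<in> V" and "\<alpha> * graph_norm v \<le> L2_norm Q (S v)"
proof -
  let ?W = "{w \<in> Wh. L2_nonzero Q w}"
  let ?q = "\<lambda>w. ennreal (cmod (A_form \<nu> T \<Omega> v w)) / (V_norm \<nu> T \<Omega> v * ennreal (L2_norm Q w))"
  have le: "ennreal \<alpha> \<le> (SUP w\<in>?W. ?q w)"
    using \<alpha>(2) v unfolding inf_sup_const_def by (auto intro: order_trans INF_lower)
  have w: "0 < L2_norm Q w" if "w \<in> ?W" for w
  proof -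
    have "L2_norm Q w \<noteq> 0"
      using that Wh L2_norm_eq_0_iff[of w Q] by (auto simp: L2_nonzero_def)
    then show ?thesis using L2_norm_nonneg[of Q w] by linarith
  qed
  show V: "v \<in> V"
  proof (rule ccontr)
    assume "v \<notin> V"
    have "?q w \<le> 0" if "w \<in> ?W" for w
    proof -
      have "V_norm \<nu> T \<Omega> v * ennreal (L2_norm Q w) = top"
        using \<open>v \<notin> V\<close> w[OF that] by (simp add: V_norm_def ennreal_top_mult)
      then show ?thesis by simp
    qed
    then have "(SUP w\<in>?W. ?q w) \<le> 0" by (intro SUP_least)
    with le have "ennreal \<alpha> \<le> 0" by (rule order_trans)
    with \<alpha>(1) show False by simp
  qed
  note D = V_D(1,2)[OF V]
  have n: "0 < graph_norm v" using graph_norm_pos D v by blast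
  have "?q w \<le> ennreal (L2_norm Q (S v) / graph_norm v)" if "w \<in> ?W" for w
  proof -
    have "w \<in> L2 Q" using that Wh by auto
    then have "cmod (A_form \<nu> T \<Omega> v w) \<le> L2_norm Q (S v) * L2_norm Q w"
      unfolding A_form_eq_ip using D by (intro L2_Cauchy_Schwarz)
    then have "cmod (A_form \<nu> T \<Omega> v w) / (graph_norm v * L2_norm Q w) \<le> L2_norm Q (S v) / graph_norm v"
      using n w[OF that] by (simp add: field_simps)
    moreover have "?q w = ennreal (cmod (A_form \<nu> T \<Omega> v w) / (graph_norm v * L2_norm Q w))"
      using n w[OF that] by (simp add: V_norm_eq[OF V] ennreal_mult'[symmetric] divide_ennreal)
    ultimately show ?thesis by (simp add: ennreal_leI)
  qed
  then have "(SUP w\<in>?W. ?q w) \<le> ennreal (L2_norm Q (S v) / graph_norm v)" by (intro SUP_least)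
  with le have "ennreal \<alpha> \<le> ennreal (L2_norm Q (S v) / graph_norm v)" by (rule order_trans)
  then have "\<alpha> \<le> L2_norm Q (S v) / graph_norm v"
    using n by (subst (asm) ennreal_le_iff) (auto simp: L2_norm_nonneg)
  then show "\<alpha> * graph_norm v \<le> L2_norm Q (S v)"
    using n by (simp add: field_simps)
qed

lemma S_ip_diff_left:
  assumes "u \<in> V" "v \<in> V" "w \<in> L2 Q"
  shows "L2_ip Q (S (\<lambda>p. u p - v p)) w = L2_ip Q (S u) w - L2_ip Q (S v) w"
proof -
  note D = V_D(2)[OF assms(1)] V_D(2)[OF assms(2)]
  have "L2_ip Q (S (\<lambda>p. u p - v p)) w = L2_ip Q (\<lambda>p. S u p - S v p) w"
    by (rule L2_ip_cong_AE[OF V_diff(2)[OF assms(1,2)] _ V_D(2)[OF V_diff(1)[OF assms(1,2)]]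
          L2_diff[OF D] assms(3,3)]) simp
  then show ?thesis by (simp only: L2_ip_diff_left[OF D assms(3)])
qed

text \<open>With \<open>a = u - uh\<close> and \<open>z = vh - uh\<close> one has \<open>u - vh = a - z\<close>. Orthogonality makes the images under
  the operator add up in squares, and Cauchy--Schwarz bounds the remaining part of the norm from below
  by the square of the difference of the two norms.\<close>

lemma quasi_optimal:
  assumes \<alpha>: "0 < \<alpha>" "\<alpha> \<le> 1"
    and u: "u \<in> V" and uh: "uh \<in> V" and vh: "vh \<in> V"
    and stable: "\<alpha> * graph_norm (\<lambda>p. vh p - uh p) \<le> L2_norm Q (S (\<lambda>p. vh p - uh p))"
    and orth: "L2_ip Q (S (\<lambda>p. u p - uh p)) (S (\<lambda>p. vh p - uh p)) = 0"
  shows "\<alpha> * graph_norm (\<lambda>p. u p - uh p) \<le> graph_norm (\<lambda>p. u p - vh p)"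
proof -
  let ?a = "\<lambda>p. u p - uh p" and ?z = "\<lambda>p. vh p - uh p"
  let ?e = "\<lambda>p. ?a p - ?z p"
  have e: "?e = (\<lambda>p. u p - vh p)" by (simp add: fun_eq_iff)
  note a = V_diff(1)[OF u uh] and z = V_diff(1)[OF vh uh]
  note D = V_D(1,2)[OF a] V_D(1,2)[OF z]
  let ?na = "L2_norm Q ?a" and ?nz = "L2_norm Q ?z" and ?ra = "L2_norm Q (S ?a)" and ?sz = "L2_norm Q (S ?z)"
  have "\<alpha>\<^sup>2 * (?nz\<^sup>2 + ?sz\<^sup>2) \<le> ?sz\<^sup>2"
    using power_mono[OF stable, of 2] \<alpha>(1) graph_norm_nonneg
    by (simp add: power_mult_distrib graph_norm_square)
  from stable_projection_inequality[OF \<alpha> this]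
  have "\<alpha>\<^sup>2 * (graph_norm ?a)\<^sup>2 \<le> (?na - ?nz)\<^sup>2 + ?ra\<^sup>2 + ?sz\<^sup>2"
    unfolding graph_norm_square .
  also have "\<dots> \<le> (graph_norm ?e)\<^sup>2"
  proof -
    have "L2_norm Q (S ?e) = L2_norm Q (\<lambda>p. S ?a p - S ?z p)"
      by (rule L2_norm_cong_AE[OF V_diff(2)[OF a z] V_D(2)[OF V_diff(1)[OF a z]] L2_diff[OF D(2,4)]])
    then have "(L2_norm Q (S ?e))\<^sup>2 = ?ra\<^sup>2 + ?sz\<^sup>2"
      using L2_norm_diff_square[OF D(2,4)] orth by simp
    moreover have "(L2_norm Q ?e)\<^sup>2 = ?na\<^sup>2 + ?nz\<^sup>2 - 2 * Re (L2_ip Q ?a ?z)"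
      by (rule L2_norm_diff_square[OF D(1,3)])
    moreover have "Re (L2_ip Q ?a ?z) \<le> ?na * ?nz"
      using L2_Cauchy_Schwarz[OF D(1,3)] complex_Re_le_cmod order_trans by blast
    ultimately show ?thesis
      unfolding graph_norm_square power2_diff by linarith
  qed
  finally have "(\<alpha> * graph_norm ?a)\<^sup>2 \<le> (graph_norm ?e)\<^sup>2" by (simp only: power_mult_distrib)
  then show ?thesis unfolding e by (rule power2_le_imp_le) (rule graph_norm_nonneg)
qed

text \<open>The discrete test space consists of all representatives of the images; testing with the chosen
  ones is equivalent.\<close>

lemma galerkin_equation_on_S_image_iff:
  assumes Vh: "Vh \<subseteq> V" and f: "f \<in> L2 Q" and u: "u \<in> V"
  shows "(\<forall>w\<in>S_image \<nu> T \<Omega> Vh. A_form \<nu> T \<Omega> u w = F_form T \<Omega> f w)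
     \<longleftrightarrow> (\<forall>v\<in>Vh. L2_ip Q (S u) (S v) = L2_ip Q f (S v))"
proof
  assume *: "\<forall>w\<in>S_image \<nu> T \<Omega> Vh. A_form \<nu> T \<Omega> u w = F_form T \<Omega> f w"
  show "\<forall>v\<in>Vh. L2_ip Q (S u) (S v) = L2_ip Q f (S v)"
  proof
    fix v assume v: "v \<in> Vh"
    then have "S v \<in> S_image \<nu> T \<Omega> Vh"
      using V_D(2,3)[of v] Vh by (auto simp: S_image_def)
    with * show "L2_ip Q (S u) (S v) = L2_ip Q f (S v)"
      by (simp add: A_form_eq_ip F_form_eq_ip)
  qed
next
  assume *: "\<forall>v\<in>Vh. L2_ip Q (S u) (S v) = L2_ip Q f (S v)"
  show "\<forall>w\<in>S_image \<nu> T \<Omega> Vh. A_form \<nu> T \<Omega> u w = F_form T \<Omega> f w"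
  proof
    fix w assume "w \<in> S_image \<nu> T \<Omega> Vh"
    then obtain v where v: "v \<in> Vh" and w: "w \<in> L2 Q" "weak_schroedinger \<nu> Q v w"
      by (auto simp: S_image_def)
    note S = S_op_eq_AE[OF w]
    have "L2_ip Q g (S v) = L2_ip Q g w" if "g \<in> L2 Q" for g
      by (rule L2_ip_cong_AE[OF _ S(3) that that S(1) w(1)]) simp
    from this[OF V_D(2)[OF u]] this[OF f] bspec[OF * v] show "A_form \<nu> T \<Omega> u w = F_form T \<Omega> f w"
      unfolding A_form_eq_ip F_form_eq_ip by metis
  qed
qed

text \<open>Tested with the images of the trial functions, the discrete problem has the Hermitian form
  \<open>(S u, S v)\<close>, which is definite as soon as \<open>S\<close> is injective on \<open>X\<close>.\<close>

lemma discrete_problem_unique_solution: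
  assumes X: "fun_space.subspace X" and XV: "X \<subseteq> V"
    and B: "finite B" "B \<subseteq> X" "fun_space.span B = X"
    and inj: "\<And>v. v \<in> X \<Longrightarrow> L2_norm Q (S v) = 0 \<Longrightarrow> v = 0" and f: "f \<in> L2 Q"
  shows "\<exists>!u. u \<in> X \<and> (\<forall>v\<in>X. L2_ip Q (S u) (S v) = L2_ip Q f (S v))"
proof -
  let ?s = "\<lambda>u v. L2_ip Q (S u) (S v)"
  have S_L2: "S v \<in> L2 Q" if "v \<in> X" for v using that XV V_D(2) by blast
  have S_add: "AE p in lebesgue_on Q. S (u + v) p = S u p + S v p" if "u \<in> X" "v \<in> X" for u v
    using V_add(2)[of u v] that XV by (auto simp: plus_fun_def)
  have S_scale: "AE p in lebesgue_on Q. S (fscale c v) p = c * S v p" if "v \<in> X" for c v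
    using V_scale(2)[of v c] that XV by (auto simp: fscale_def)
  have add_X: "u + v \<in> X" if "u \<in> X" "v \<in> X" for u v
    using that X by (simp add: fun_space.subspace_add)
  have scale_X: "fscale c v \<in> X" if "v \<in> X" for c v
    using that X by (simp add: fun_space.subspace_scale)
  have anti: "antilinear_on X (\<lambda>v. L2_ip Q g (S v))" if g: "g \<in> L2 Q" for g
    unfolding antilinear_on_def
  proof (intro conjI ballI allI)
    fix u v assume uv: "u \<in> X" "v \<in> X"
    have "L2_ip Q g (S (u + v)) = L2_ip Q g (\<lambda>p. S u p + S v p)"
      by (rule L2_ip_cong_AE[OF _ S_add[OF uv] g g S_L2[OF add_X[OF uv]] L2_add[OF S_L2 S_L2, OF uv]]) simp
    then show "L2_ip Q g (S (u + v)) = L2_ip Q g (S u) + L2_ip Q g (S v)"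
      by (simp add: L2_ip_add_right[OF g S_L2 S_L2, OF uv])
  next
    fix c v assume v: "v \<in> X"
    have "L2_ip Q g (S (fscale c v)) = L2_ip Q g (\<lambda>p. c * S v p)"
      by (rule L2_ip_cong_AE[OF _ S_scale[OF v] g g S_L2[OF scale_X[OF v]] L2_scale[OF S_L2[OF v]]]) simp
    then show "L2_ip Q g (S (fscale c v)) = cnj c * L2_ip Q g (S v)"
      by (simp add: L2_ip_scale_right)
  qed
  have definite: "v = 0" if "v \<in> X" "?s v v = 0" for v
    using inj[OF that(1)] that(2) by (simp add: L2_ip_self)
  have s_add: "?s (u + u') v = ?s u v + ?s u' v" if "u \<in> X" "u' \<in> X" "v \<in> X" for u u' v
    using anti[OF S_L2[OF that(3)]] that unfolding antilinear_on_def
    by (simp add: L2_ip_commute[of Q "S (_ :: real \<times> (real^'d) \<Rightarrow> complex)" "S v"])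
  have s_scale: "?s (fscale c u) v = c * ?s u v" if "u \<in> X" "v \<in> X" for c u v
    using anti[OF S_L2[OF that(2)]] that unfolding antilinear_on_def
    by (simp add: L2_ip_commute[of Q "S (_ :: real \<times> (real^'d) \<Rightarrow> complex)" "S v"])
  obtain u where u: "u \<in> X" "\<forall>v\<in>X. ?s u v = L2_ip Q f (S v)"
    using finite_dim_riesz[of X ?s B "\<lambda>v. L2_ip Q f (S v)", OF X s_add s_scale anti[OF S_L2] definite B(1,2) anti[OF f]]
    unfolding B(3) by blast
  show ?thesis
  proof (rule ex1I[of _ u])
    show "u \<in> X \<and> (\<forall>v\<in>X. ?s u v = L2_ip Q f (S v))" using u by blast
  next
    fix u' assume u': "u' \<in> X \<and> (\<forall>v\<in>X. ?s u' v = L2_ip Q f (S v))"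
    let ?d = "u' + fscale (- 1) u"
    have d: "?d \<in> X" using u u' by (intro add_X scale_X) auto
    have "?s ?d ?d = ?s u' ?d + ?s (fscale (- 1) u) ?d"
      using u' by (intro s_add scale_X u(1) d) blast
    also have "?s (fscale (- 1) u) ?d = - 1 * ?s u ?d"
      by (rule s_scale[OF u(1) d])
    also have "?s u ?d = L2_ip Q f (S ?d)" using u(2) d by blast
    also have "?s u' ?d = L2_ip Q f (S ?d)" using u' d by blast
    also have "L2_ip Q f (S ?d) + - 1 * L2_ip Q f (S ?d) = 0"
      by (simp only: mult_minus_left mult_1 add.right_inverse)
    finally have "?d = 0" using definite d by blast
    then show "u' = u" by (simp add: fun_eq_iff fscale_def)
  qed
qed

end

theorem theorem1:
  fixes \<Omega> :: "(real^'d) set" and T \<nu> \<theta> \<alpha> :: real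
    and f :: "real \<times> (real^'d) \<Rightarrow> complex"
    and F :: "real^'d \<Rightarrow> real^'d" and pt ps :: nat
    and \<Xi>t :: "'h \<Rightarrow> real list" and \<Xi>s :: "'h \<Rightarrow> 'd \<Rightarrow> real list"
    and Vh Wh :: "'h \<Rightarrow> (real \<times> (real^'d) \<Rightarrow> complex) set"
  assumes "bounded \<Omega>" and "lipschitz_domain \<Omega>" and "T > 0" and "\<nu> > 0"
    and "f \<in> L2 (cylinder T \<Omega>)"
    and "pt \<ge> 1" and "ps \<ge> 2" and "\<theta> \<ge> 1"
    and "\<And>h. open_knot_vector pt (\<Xi>t h)"
    and "\<And>h j. open_knot_vector ps (\<Xi>s h j)"
    and "\<And>h s. s \<in> spline_space pt (\<Xi>t h) \<Longrightarrow> continuous_on {0<..<1} s"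
    and "\<And>h s. s \<in> tensor_spline_space ps (\<Xi>s h) \<Longrightarrow> C1_on (box 0 1) s"
    and "\<And>h. locally_quasi_uniform \<theta> (\<Xi>t h)"
    and "\<And>h j. locally_quasi_uniform \<theta> (\<Xi>s h j)"
    and "\<And>h. spline_parametrization ps (\<Xi>s h) \<Omega> F"
    and "\<And>h. Vh h = V_h T \<Omega> F pt ps (\<Xi>t h) (\<Xi>s h)"
    and "\<And>h. Wh h = S_image \<nu> T \<Omega> (Vh h)"
    and "\<alpha> > 0"
    and "\<And>h. ennreal \<alpha> \<le> inf_sup_const \<nu> T \<Omega> (Vh h) (Wh h)"
  shows "\<forall>h. (\<exists>!uh. uh \<in> Vh h \<and> (\<forall>wh\<in>Wh h. A_form \<nu> T \<Omega> uh wh = F_form T \<Omega> f wh)) \<and>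
     (\<forall>u\<in>V_space \<nu> T \<Omega>. \<forall>uh\<in>Vh h.
        (\<forall>w\<in>L2 (cylinder T \<Omega>). A_form \<nu> T \<Omega> u w = F_form T \<Omega> f w) \<longrightarrow>
        (\<forall>wh\<in>Wh h. A_form \<nu> T \<Omega> uh wh = F_form T \<Omega> f wh) \<longrightarrow>
        V_norm \<nu> T \<Omega> (\<lambda>p. u p - uh p)
          \<le> ennreal (1 / \<alpha>) * (INF vh\<in>Vh h. V_norm \<nu> T \<Omega> (\<lambda>p. u p - vh p)))"
proof (rule allI)
  fix h
  interpret schroedinger_cylinder \<nu> T \<Omega>
    using assms(1,2) by unfold_locales (auto simp: lipschitz_domain_def)
  let ?V = "Vh h" and ?W = "Wh h"
  note f = assms(5) and \<alpha> = assms(18,19) and W = assms(17)[of h] and Vh_eq = assms(16)[of h]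
  have spatial: "continuous_on (box 0 1) s" if "s \<in> tensor_spline_space ps (\<Xi>s h)" for s
    using assms(12)[OF that] unfolding C1_on_def
    by (auto intro!: continuous_at_imp_continuous_on differentiable_imp_continuous_within)
  have temporal: "continuous_on {0<..<1} s" if "s \<in> spline_space pt (\<Xi>t h)" for s
    by (rule assms(11)[OF that])
  have sub: "fun_space.subspace ?V" unfolding Vh_eq by (rule subspace_V_h)
  have nonzero: "L2_nonzero Q v" if "v \<in> ?V" "v \<noteq> 0" for v
    using V_h_eq_0_if_AE[OF assms(3) temporal spatial assms(15)] that
    unfolding Vh_eq L2_nonzero_def by blast
  have WL2: "?W \<subseteq> L2 Q" unfolding W S_image_def by blast
  note stable = inf_sup_const_imp_stable[OF \<alpha>(1) \<alpha>(2)[of h] WL2]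
  have VhV: "?V \<subseteq> V"
  proof
    fix v assume v: "v \<in> ?V"
    show "v \<in> V"
    proof (cases "v = 0")
      case True
      then show ?thesis using V_zero by (simp add: zero_fun_def)
    next
      case False
      then show ?thesis using stable(1)[OF v nonzero[OF v]] by blast
    qed
  qed
  have L2_0: "L2_norm Q (S 0) = 0"
  proof -
    have "AE p in lebesgue_on Q. S (\<lambda>p. 0) p = 0"
      using V_scale(2)[OF V_zero, of 0] by simp
    then show ?thesis
      using L2_norm_eq_0_iff[OF V_D(2)[OF V_zero]] by (simp add: zero_fun_def)
  qed
  have stable': "\<alpha> * graph_norm v \<le> L2_norm Q (S v)" if v: "v \<in> ?V" for v
  proof (cases "v = 0")
    case True
    then show ?thesis using L2_0 by (simp add: graph_norm_def L2_norm_def)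
  next
    case False
    then show ?thesis using stable(2)[OF v nonzero[OF v]] by blast
  qed
  have pos: "0 < graph_norm v" if "v \<in> ?V" "v \<noteq> 0" for v
    using graph_norm_pos nonzero[OF that] V_D(1) VhV that(1) by blast
  have inj: "v = 0" if "v \<in> ?V" "L2_norm Q (S v) = 0" for v
    using stable'[OF that(1)] pos[OF that(1)] \<alpha>(1) that(2)
    by (smt (verit, best) mult_pos_pos)
  \<comment> \<open>If the discrete space were trivial, the inf-sup constant would be infinite and the error bound
    could fail for \<open>\<alpha> > 1\<close>; a nonzero discrete function excludes this.\<close>
  have "\<alpha> \<le> 1"
  proof -
    have bij: "bij_betw F (box 0 1) \<Omega>" using assms(15) by (simp add: spline_parametrization_def)
    obtain v where v: "v \<in> ?V" "v \<noteq> 0"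
      using V_h_nontrivial[OF assms(3) bij assms(9) assms(6), of ps "\<Xi>s h" h, OF assms(10) assms(7)]
      unfolding Vh_eq by blast
    have "\<alpha> * graph_norm v \<le> L2_norm Q (S v)" by (rule stable'[OF v(1)])
    also have "\<dots> \<le> graph_norm v"
      unfolding graph_norm_def by (rule real_le_rsqrt) simp
    finally show ?thesis using pos[OF v] by simp
  qed
  obtain B where B: "finite B" "B \<subseteq> ?V" "fun_space.span B = ?V"
    unfolding Vh_eq by (rule V_h_finite_basis)
  have galerkin: "(\<forall>wh\<in>?W. A_form \<nu> T \<Omega> u wh = F_form T \<Omega> f wh)
      \<longleftrightarrow> (\<forall>v\<in>?V. L2_ip Q (S u) (S v) = L2_ip Q f (S v))" if "u \<in> V" for u
    unfolding W by (rule galerkin_equation_on_S_image_iff[OF VhV f that])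
  have "\<exists>!uh. uh \<in> ?V \<and> (\<forall>wh\<in>?W. A_form \<nu> T \<Omega> uh wh = F_form T \<Omega> f wh)"
  proof -
    have "uh \<in> ?V \<and> (\<forall>wh\<in>?W. A_form \<nu> T \<Omega> uh wh = F_form T \<Omega> f wh)
        \<longleftrightarrow> uh \<in> ?V \<and> (\<forall>v\<in>?V. L2_ip Q (S uh) (S v) = L2_ip Q f (S v))" for uh
      using galerkin[OF subsetD[OF VhV]] by (rule conj_cong[OF refl])
    then show ?thesis
      using discrete_problem_unique_solution[OF sub VhV B inj f] by simp
  qed
  moreover have "V_norm \<nu> T \<Omega> (\<lambda>p. u p - uh p)
      \<le> ennreal (1 / \<alpha>) * (INF vh\<in>?V. V_norm \<nu> T \<Omega> (\<lambda>p. u p - vh p))"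
    if u: "u \<in> V" and uh: "uh \<in> ?V"
      and sol: "\<forall>w\<in>L2 Q. A_form \<nu> T \<Omega> u w = F_form T \<Omega> f w"
      and sol_h: "\<forall>wh\<in>?W. A_form \<nu> T \<Omega> uh wh = F_form T \<Omega> f wh" for u uh
  proof -
    let ?e = "graph_norm (\<lambda>p. u p - uh p)"
    have uhV: "uh \<in> V" using uh VhV by blast
    have orth: "L2_ip Q (S (\<lambda>p. u p - uh p)) (S v) = 0" if v: "v \<in> ?V" for v
    proof -
      have Sv: "S v \<in> L2 Q" using V_D(2) v VhV by blast
      have "L2_ip Q (S u) (S v) = L2_ip Q f (S v)"
        using sol Sv by (simp add: A_form_eq_ip F_form_eq_ip)
      moreover have "L2_ip Q (S uh) (S v) = L2_ip Q f (S v)"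
        using sol_h galerkin[OF uhV] v by blast
      ultimately show ?thesis by (simp add: S_ip_diff_left[OF u uhV Sv])
    qed
    have "ennreal (\<alpha> * ?e) \<le> (INF vh\<in>?V. V_norm \<nu> T \<Omega> (\<lambda>p. u p - vh p))"
    proof (rule INF_greatest)
      fix vh assume vh: "vh \<in> ?V"
      then have vhV: "vh \<in> V" using VhV by blast
      have d: "(\<lambda>p. vh p - uh p) \<in> ?V"
        using fun_space.subspace_diff[OF sub vh uh] by (simp add: fun_diff_def)
      have "\<alpha> * ?e \<le> graph_norm (\<lambda>p. u p - vh p)"
        by (rule quasi_optimal[OF \<alpha>(1) \<open>\<alpha> \<le> 1\<close> u uhV vhV stable'[OF d] orth[OF d]])
      then show "ennreal (\<alpha> * ?e) \<le> V_norm \<nu> T \<Omega> (\<lambda>p. u p - vh p)"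
        by (simp add: V_norm_eq[OF V_diff(1)[OF u vhV]] ennreal_leI)
    qed
    then have "ennreal (1 / \<alpha>) * ennreal (\<alpha> * ?e)
        \<le> ennreal (1 / \<alpha>) * (INF vh\<in>?V. V_norm \<nu> T \<Omega> (\<lambda>p. u p - vh p))"
      by (rule mult_left_mono) simp
    moreover have "ennreal (1 / \<alpha>) * ennreal (\<alpha> * ?e) = ennreal ?e"
      using \<alpha>(1) graph_norm_nonneg by (simp add: ennreal_mult'[symmetric])
    ultimately show ?thesis
      by (simp add: V_norm_eq[OF V_diff(1)[OF u uhV]])
  qed
  ultimately show "(\<exists>!uh. uh \<in> ?V \<and> (\<forall>wh\<in>?W. A_form \<nu> T \<Omega> uh wh = F_form T \<Omega> f wh)) \<and>
     (\<forall>u\<in>V. \<forall>uh\<in>?V.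
        (\<forall>w\<in>L2 Q. A_form \<nu> T \<Omega> u w = F_form T \<Omega> f w) \<longrightarrow>
        (\<forall>wh\<in>?W. A_form \<nu> T \<Omega> uh wh = F_form T \<Omega> f wh) \<longrightarrow>
        V_norm \<nu> T \<Omega> (\<lambda>p. u p - uh p)
          \<le> ennreal (1 / \<alpha>) * (INF vh\<in>?V. V_norm \<nu> T \<Omega> (\<lambda>p. u p - vh p)))"
    by blast
qed

end
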